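(* Let $(n_1,\dots,n_k)\in\mathbb N^k$ and let $F:B(\mathcal H)^{n_1}\times_c\cdots\times_cB(\mathcal H)^{n_k}\to B(\mathcal K)\otimes_{min}B(\mathcal H)$ be an entire function (with coefficients in $B(\mathcal K)$) with the property that there are a constant $C>0$ and $(q_1,\dots,q_k)\in\mathbb Z_+^k$ such that $$\|F(\mathbf X)\|\le C\Big\|\sum_{\substack{\alpha_i\in\mathbb F_{n_i}^+,\ |\alpha_i|=q_i\\ i\in\{1,\dots,k\}}}X_{(\alpha)}X_{(\alpha)}^*\Big\|^{1/2}$$ for any $\mathbf X\in B(\mathcal H)^{n_1}\times_c\cdots\times_cB(\mathcal H)^{n_k}$ (and any Hilbert space $\mathcal H$). Then $F$ is a polynomial of degree at most $q_1+\cdots+q_k$. In particular, a bounded entire free holomorphic function must be constant.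
   Context: **Polyball.** For a complex Hilbert space $\mathcal H$, $B(\mathcal H)^{n_1}\times_c\cdots\times_c B(\mathcal H)^{n_k}$ is the set of tuples $\mathbf X=(X_1,\dots,X_k)$, $X_i=(X_{i,1},\dots,X_{i,n_i})\in B(\mathcal H)^{n_i}$, such that each entry of $X_s$ commutes with each entry of $X_t$ whenever $s\neq t$ (entries of a single $X_s$ need not commute). Put $\Phi_{X_i}(Y)=\sum_{j=1}^{n_i}X_{i,j}YX_{i,j}^*$ and $\mathbf\Delta_{\mathbf X}=(id-\Phi_{X_1})\circ\cdots\circ(id-\Phi_{X_k})$ on $B(\mathcal H)$. The regular polyball $\mathbf B_{\mathbf n}(\mathcal H)$ is the set of all such $\mathbf X$ with $\|\sum_jX_{i,j}X_{i,j}^*\|<1$ for each $i$ and $\mathbf\Delta_{\mathbf X}(I)>0$ (positive and invertible). One has $B(\mathcal H)^{n_1}\times_c\cdots\times_cB(\mathcal H)^{n_k}=\bigcup_{\rho>0}\rho\mathbf B_{\mathbf n}(\mathcal H)$. **Free holomorphic and entire functions.** $\mathbb F_{n_i}^+$ is the unital free semigroup on generators $g^i_1,\dots,g^i_{n_i}$, with word length $|\cdot|$. For $\alpha=g^i_{j_1}\cdots g^i_{j_p}$ put $X_{i,\alpha}=X_{i,j_1}\cdots X_{i,j_p}$ ($I$ for the empty word), and for $(\alpha)=(\alpha_1,\dots,\alpha_k)$ put $X_{(\alpha)}=X_{1,\alpha_1}\cdots X_{k,\alpha_k}$. A formal power series $F=\sum_{(\alpha)}A_{(\alpha)}\otimes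 Z_{(\alpha)}$, $A_{(\alpha)}\in B(\mathcal K)$ ($\mathcal K$ a Hilbert space), is free holomorphic on $\rho\mathbf B_{\mathbf n}$, $\rho>0$, if $F(\mathbf X)=\sum_{(p_1,\dots,p_k)\in\mathbb Z_+^k}\sum_{|\alpha_i|=p_i}A_{(\alpha)}\otimes X_{(\alpha)}$ converges in operator norm for all $\mathbf X\in\rho\mathbf B_{\mathbf n}(\mathcal H)$ and all Hilbert spaces $\mathcal H$. $F$ is entire if it is free holomorphic on $\rho\mathbf B_{\mathbf n}$ for every $\rho>0$. Properties of $F$ are understood for its representations on all Hilbert spaces $\mathcal H$. $F$ is a polynomial of degree at most $d$ if $A_{(\alpha)}=0$ whenever $|\alpha_1|+\cdots+|\alpha_k|>d$. *)

theory Defs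
  imports
    Complex_Main
    "HOL-Algebra.Module"
    "HOL-Algebra.Algebraic_Closure_Type"
    "HOL-Library.FuncSet"
    "HOL-Library.Infinite_Typeclass"
begin

no_notation Polynomials.var (\<open>X\<index>\<close>)

section \<open>Hilbert spaces and bounded operators\<close>

text \<open>
  The statement quantifies over all Hilbert spaces inside its hypotheses, so Hilbert spaces are
  carrier-based structures rather than types.  The fields \<open>mult\<close> and \<open>one\<close> that the record inherits
  from HOL-Algebra carry no meaning for a Hilbert space.
\<close>

record 'a hspace = "(complex, 'a) module" +
  hinner :: "'a \<Rightarrow> 'a \<Rightarrow> complex"

definition hnorm :: "'a hspace \<Rightarrow> 'a \<Rightarrow> real" where
  "hnorm H x = sqrt (Re (hinner H x x))"

locale hilbert_space = module "ring_of_type_algebra :: complex ring" H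
  for H :: "'a hspace" (structure) +
  assumes hinner_add:
      "\<lbrakk>x \<in> carrier H; y \<in> carrier H; z \<in> carrier H\<rbrakk>
        \<Longrightarrow> hinner H (x \<oplus> y) z = hinner H x z + hinner H y z"
    and hinner_smult:
      "\<lbrakk>x \<in> carrier H; y \<in> carrier H\<rbrakk> \<Longrightarrow> hinner H (c \<odot> x) y = c * hinner H x y"
    and hinner_commute:
      "\<lbrakk>x \<in> carrier H; y \<in> carrier H\<rbrakk> \<Longrightarrow> hinner H y x = cnj (hinner H x y)"
    and hinner_pos:
      "\<lbrakk>x \<in> carrier H; x \<noteq> \<zero>\<rbrakk> \<Longrightarrow> Re (hinner H x x) > 0"
    and complete:
      "\<lbrakk>\<And>m. s m \<in> carrier H; \<forall>e>0. \<exists>N. \<forall>m\<ge>N. \<forall>l\<ge>N. hnorm H (s m \<ominus> s l) < e\<rbrakk>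
        \<Longrightarrow> \<exists>x\<in>carrier H. (\<lambda>m. hnorm H (s m \<ominus> x)) \<longlonglongrightarrow> 0"

text \<open>
  The algebra $B(H)$.  Operators are extensional functions on the carrier, so that equality of
  operators is equality in HOL.
\<close>

definition bop :: "'a hspace \<Rightarrow> (complex, 'a \<Rightarrow> 'a) module" where
  "bop H = \<lparr>
     carrier = {T \<in> carrier H \<rightarrow>\<^sub>E carrier H.
        (\<forall>x\<in>carrier H. \<forall>y\<in>carrier H. T (x \<oplus>\<^bsub>H\<^esub> y) = T x \<oplus>\<^bsub>H\<^esub> T y) \<and>
        (\<forall>c. \<forall>x\<in>carrier H. T (c \<odot>\<^bsub>H\<^esub> x) = c \<odot>\<^bsub>H\<^esub> T x) \<and>
        (\<exists>M. \<forall>x\<in>carrier H. hnorm H (T x) \<le> M * hnorm H x)},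
     monoid.mult = compose (carrier H),
     one = (\<lambda>x\<in>carrier H. x),
     ring.zero = (\<lambda>x\<in>carrier H. \<zero>\<^bsub>H\<^esub>),
     add = (\<lambda>S T. \<lambda>x\<in>carrier H. S x \<oplus>\<^bsub>H\<^esub> T x),
     module.smult = (\<lambda>c T. \<lambda>x\<in>carrier H. c \<odot>\<^bsub>H\<^esub> T x)\<rparr>"

definition opnorm :: "'a hspace \<Rightarrow> ('a \<Rightarrow> 'a) \<Rightarrow> real" where
  "opnorm H T = (SUP x\<in>{x \<in> carrier H. hnorm H x \<le> 1}. hnorm H (T x))"

definition adj :: "'a hspace \<Rightarrow> ('a \<Rightarrow> 'a) \<Rightarrow> ('a \<Rightarrow> 'a)" where
  "adj H T = (THE S. S \<in> carrier (bop H) \<and>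
     (\<forall>x\<in>carrier H. \<forall>y\<in>carrier H. hinner H (T x) y = hinner H x (S y)))"

definition positive_invertible :: "'a hspace \<Rightarrow> ('a \<Rightarrow> 'a) \<Rightarrow> bool" where
  "positive_invertible H T \<longleftrightarrow> T \<in> Units (bop H) \<and>
     (\<forall>x\<in>carrier H. Im (hinner H (T x) x) = 0 \<and> 0 \<le> Re (hinner H (T x) x))"

definition op_prod :: "'a hspace \<Rightarrow> ('a \<Rightarrow> 'a) list \<Rightarrow> ('a \<Rightarrow> 'a)" where
  "op_prod H Ts = foldr (\<lambda>S T. S \<otimes>\<^bsub>bop H\<^esub> T) Ts \<one>\<^bsub>bop H\<^esub>"

text \<open>
  \<open>(L, \<tau>)\<close> is a Hilbert space tensor product of \<open>K\<close> and \<open>H\<close>, where \<open>\<tau> x y\<close> is the elementary tensor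
  of \<open>x\<close> and \<open>y\<close>.  This determines \<open>(L, \<tau>)\<close> up to a unique unitary that respects elementary tensors.
\<close>

definition hilbert_tensor ::
  "'k hspace \<Rightarrow> 'h hspace \<Rightarrow> 'l hspace \<Rightarrow> ('k \<Rightarrow> 'h \<Rightarrow> 'l) \<Rightarrow> bool" where
  "hilbert_tensor K H L \<tau> \<longleftrightarrow>
     hilbert_space K \<and> hilbert_space H \<and> hilbert_space L \<and>
     (\<forall>x\<in>carrier K. \<forall>y\<in>carrier H. \<tau> x y \<in> carrier L) \<and>
     (\<forall>x\<in>carrier K. \<forall>x'\<in>carrier K. \<forall>y\<in>carrier H. \<tau> (x \<oplus>\<^bsub>K\<^esub> x') y = \<tau> x y \<oplus>\<^bsub>L\<^esub> \<tau> x' y) \<and>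
     (\<forall>x\<in>carrier K. \<forall>y\<in>carrier H. \<forall>y'\<in>carrier H. \<tau> x (y \<oplus>\<^bsub>H\<^esub> y') = \<tau> x y \<oplus>\<^bsub>L\<^esub> \<tau> x y') \<and>
     (\<forall>c. \<forall>x\<in>carrier K. \<forall>y\<in>carrier H.
        \<tau> (c \<odot>\<^bsub>K\<^esub> x) y = c \<odot>\<^bsub>L\<^esub> \<tau> x y \<and> \<tau> x (c \<odot>\<^bsub>H\<^esub> y) = c \<odot>\<^bsub>L\<^esub> \<tau> x y) \<and>
     (\<forall>x\<in>carrier K. \<forall>x'\<in>carrier K. \<forall>y\<in>carrier H. \<forall>y'\<in>carrier H.
        hinner L (\<tau> x y) (\<tau> x' y') = hinner K x x' * hinner H y y') \<and>
     (\<forall>z\<in>carrier L. \<forall>e>0. \<exists>(m::nat) u v. (\<forall>i<m. u i \<in> carrier K \<and> v i \<in> carrier H) \<and>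
        hnorm L (z \<ominus>\<^bsub>L\<^esub> (\<Oplus>\<^bsub>L\<^esub>i\<in>{..<m}. \<tau> (u i) (v i))) < e)"

text \<open>The operator $A \otimes T$ on \<open>L\<close>.\<close>

definition op_tensor ::
  "'k hspace \<Rightarrow> 'h hspace \<Rightarrow> 'l hspace \<Rightarrow> ('k \<Rightarrow> 'h \<Rightarrow> 'l) \<Rightarrow>
    ('k \<Rightarrow> 'k) \<Rightarrow> ('h \<Rightarrow> 'h) \<Rightarrow> ('l \<Rightarrow> 'l)" where
  "op_tensor K H L \<tau> A T = (THE S. S \<in> carrier (bop L) \<and>
     (\<forall>x\<in>carrier K. \<forall>y\<in>carrier H. S (\<tau> x y) = \<tau> (A x) (T y)))"


section \<open>Regular polyballs\<close>

text \<open>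
  \<open>n\<close> is the list $(n_1,\dots,n_k)$, and a tuple $\mathbf X$ is a list of \<open>length n\<close> lists of operators,
  indexed from 0.
\<close>

definition commuting_tuples :: "'h hspace \<Rightarrow> nat list \<Rightarrow> ('h \<Rightarrow> 'h) list list set" where
  "commuting_tuples H n = {X. map length X = n \<and>
     (\<forall>i<length n. set (X ! i) \<subseteq> carrier (bop H)) \<and>
     (\<forall>s<length n. \<forall>t<length n. s \<noteq> t \<longrightarrow>
        (\<forall>S\<in>set (X ! s). \<forall>T\<in>set (X ! t). S \<otimes>\<^bsub>bop H\<^esub> T = T \<otimes>\<^bsub>bop H\<^esub> S))}"

definition Phi :: "'h hspace \<Rightarrow> ('h \<Rightarrow> 'h) list \<Rightarrow> ('h \<Rightarrow> 'h) \<Rightarrow> ('h \<Rightarrow> 'h)" where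
  "Phi H Xi Y =
     (\<Oplus>\<^bsub>bop H\<^esub>j\<in>{..<length Xi}. (Xi ! j) \<otimes>\<^bsub>bop H\<^esub> Y \<otimes>\<^bsub>bop H\<^esub> adj H (Xi ! j))"

definition Delta :: "'h hspace \<Rightarrow> ('h \<Rightarrow> 'h) list list \<Rightarrow> ('h \<Rightarrow> 'h) \<Rightarrow> ('h \<Rightarrow> 'h)" where
  "Delta H X = foldr (\<lambda>Xi D. (\<lambda>Y. Y \<ominus>\<^bsub>bop H\<^esub> Phi H Xi Y) \<circ> D) X id"

definition polyball :: "'h hspace \<Rightarrow> nat list \<Rightarrow> ('h \<Rightarrow> 'h) list list set" where
  "polyball H n = {X \<in> commuting_tuples H n.
     (\<forall>i<length n.
        opnorm H (\<Oplus>\<^bsub>bop H\<^esub>j\<in>{..<n ! i}. (X ! i ! j) \<otimes>\<^bsub>bop H\<^esub> adj H (X ! i ! j)) < 1) \<and>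
     positive_invertible H (Delta H X \<one>\<^bsub>bop H\<^esub>)}"

definition scaled_polyball ::
  "'h hspace \<Rightarrow> nat list \<Rightarrow> real \<Rightarrow> ('h \<Rightarrow> 'h) list list set" where
  "scaled_polyball H n \<rho> =
     (\<lambda>X. map (map (\<lambda>T. complex_of_real \<rho> \<odot>\<^bsub>bop H\<^esub> T)) X) ` polyball H n"


section \<open>Free holomorphic functions\<close>

text \<open>
  A word in the generators $g^i_1,\dots,g^i_{n_i}$ is the list of its indices, shifted to start at 0;
  $(\alpha)$ is the list $(\alpha_1,\dots,\alpha_k)$ of such words.
\<close>

definition multiwords :: "nat list \<Rightarrow> nat list list set" where
  "multiwords n = {\<alpha>. length \<alpha> = length n \<and> (\<forall>i<length n. set (\<alpha> ! i) \<subseteq> {..<n ! i})}"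

definition multiwords_of_length :: "nat list \<Rightarrow> nat list \<Rightarrow> nat list list set" where
  "multiwords_of_length n p = {\<alpha> \<in> multiwords n. map length \<alpha> = p}"

definition word_op :: "'h hspace \<Rightarrow> ('h \<Rightarrow> 'h) list \<Rightarrow> nat list \<Rightarrow> ('h \<Rightarrow> 'h)" where
  "word_op H Xi w = op_prod H (map (\<lambda>j. Xi ! j) w)"

definition multiword_op ::
  "'h hspace \<Rightarrow> ('h \<Rightarrow> 'h) list list \<Rightarrow> nat list list \<Rightarrow> ('h \<Rightarrow> 'h)" where
  "multiword_op H X \<alpha> = op_prod H (map2 (word_op H) X \<alpha>)"

text \<open>
  A formal power series with coefficients in $B(K)$ is its coefficient family \<open>A\<close>, indexed by
  \<open>multiwords n\<close>.
\<close>

definition homogeneous_part ::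
  "'k hspace \<Rightarrow> 'h hspace \<Rightarrow> 'l hspace \<Rightarrow> ('k \<Rightarrow> 'h \<Rightarrow> 'l) \<Rightarrow> nat list \<Rightarrow>
    (nat list list \<Rightarrow> 'k \<Rightarrow> 'k) \<Rightarrow> ('h \<Rightarrow> 'h) list list \<Rightarrow> nat list \<Rightarrow> ('l \<Rightarrow> 'l)" where
  "homogeneous_part K H L \<tau> n A X p =
     (\<Oplus>\<^bsub>bop L\<^esub>\<alpha>\<in>multiwords_of_length n p. op_tensor K H L \<tau> (A \<alpha>) (multiword_op H X \<alpha>))"

text \<open>
  \<open>T\<close> is the sum of the series at \<open>X\<close>: the series over $(p_1,\dots,p_k)\in\mathbb Z_+^k$ comes without an
  order of summation, so convergence is that of the net of finite partial sums.
\<close>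

definition has_value ::
  "'k hspace \<Rightarrow> 'h hspace \<Rightarrow> 'l hspace \<Rightarrow> ('k \<Rightarrow> 'h \<Rightarrow> 'l) \<Rightarrow> nat list \<Rightarrow>
    (nat list list \<Rightarrow> 'k \<Rightarrow> 'k) \<Rightarrow> ('h \<Rightarrow> 'h) list list \<Rightarrow> ('l \<Rightarrow> 'l) \<Rightarrow> bool" where
  "has_value K H L \<tau> n A X T \<longleftrightarrow> T \<in> carrier (bop L) \<and>
     ((\<lambda>P. opnorm L ((\<Oplus>\<^bsub>bop L\<^esub>p\<in>P. homogeneous_part K H L \<tau> n A X p) \<ominus>\<^bsub>bop L\<^esub> T)) \<longlongrightarrow> 0)
       (finite_subsets_at_top {p. length p = length n})"

definition value_at ::
  "'k hspace \<Rightarrow> 'h hspace \<Rightarrow> 'l hspace \<Rightarrow> ('k \<Rightarrow> 'h \<Rightarrow> 'l) \<Rightarrow> nat list \<Rightarrow>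
    (nat list list \<Rightarrow> 'k \<Rightarrow> 'k) \<Rightarrow> ('h \<Rightarrow> 'h) list list \<Rightarrow> ('l \<Rightarrow> 'l)" where
  "value_at K H L \<tau> n A X = (THE T. has_value K H L \<tau> n A X T)"

text \<open>
  Below, ``all Hilbert spaces \<open>H\<close>'' means all Hilbert spaces whose carrier is a set of elements of
  a type \<open>'h\<close>, which is passed as a parameter because HOL cannot quantify over types within a formula.
  Tensor products are taken on subsets of \<open>'k \<times> 'h \<Rightarrow> complex\<close>.  This type accommodates a tensor
  product of any \<open>K\<close> and \<open>H\<close>: a vector $z$ of the tensor product is determined by the function
  $(x,y)\mapsto\langle z, x\otimes y\rangle$.
\<close>

definition free_holomorphic ::
  "'h itself \<Rightarrow> 'k hspace \<Rightarrow> nat list \<Rightarrow> real \<Rightarrow> (nat list list \<Rightarrow> 'k \<Rightarrow> 'k) \<Rightarrow> bool" where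
  "free_holomorphic _ K n \<rho> A \<longleftrightarrow>
     A \<in> multiwords n \<rightarrow> carrier (bop K) \<and>
     (\<forall>(H :: 'h hspace) (L :: ('k \<times> 'h \<Rightarrow> complex) hspace) \<tau>. hilbert_tensor K H L \<tau> \<longrightarrow>
        (\<forall>X\<in>scaled_polyball H n \<rho>. \<exists>T. has_value K H L \<tau> n A X T))"

definition entire ::
  "'h itself \<Rightarrow> 'k hspace \<Rightarrow> nat list \<Rightarrow> (nat list list \<Rightarrow> 'k \<Rightarrow> 'k) \<Rightarrow> bool" where
  "entire U K n A \<longleftrightarrow> (\<forall>\<rho>>0. free_holomorphic U K n \<rho> A)"

definition growth_bound ::
  "'h itself \<Rightarrow> 'k hspace \<Rightarrow> nat list \<Rightarrow> (nat list list \<Rightarrow> 'k \<Rightarrow> 'k) \<Rightarrow> real \<Rightarrow> nat list \<Rightarrow> bool"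
  where
  "growth_bound _ K n A C q \<longleftrightarrow>
     (\<forall>(H :: 'h hspace) (L :: ('k \<times> 'h \<Rightarrow> complex) hspace) \<tau>. hilbert_tensor K H L \<tau> \<longrightarrow>
        (\<forall>X\<in>commuting_tuples H n.
           opnorm L (value_at K H L \<tau> n A X) \<le>
             C * sqrt (opnorm H (\<Oplus>\<^bsub>bop H\<^esub>\<alpha>\<in>multiwords_of_length n q.
                    multiword_op H X \<alpha> \<otimes>\<^bsub>bop H\<^esub> adj H (multiword_op H X \<alpha>)))))"

definition bounded_function ::
  "'h itself \<Rightarrow> 'k hspace \<Rightarrow> nat list \<Rightarrow> (nat list list \<Rightarrow> 'k \<Rightarrow> 'k) \<Rightarrow> bool" where
  "bounded_function _ K n A \<longleftrightarrow>
     (\<exists>M. \<forall>(H :: 'h hspace) (L :: ('k \<times> 'h \<Rightarrow> complex) hspace) \<tau>. hilbert_tensor K H L \<tau> \<longrightarrow>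
        (\<forall>X\<in>commuting_tuples H n. opnorm L (value_at K H L \<tau> n A X) \<le> M))"

definition constant_function ::
  "'h itself \<Rightarrow> 'k hspace \<Rightarrow> nat list \<Rightarrow> (nat list list \<Rightarrow> 'k \<Rightarrow> 'k) \<Rightarrow> bool" where
  "constant_function _ K n A \<longleftrightarrow>
     (\<forall>(H :: 'h hspace) (L :: ('k \<times> 'h \<Rightarrow> complex) hspace) \<tau>. hilbert_tensor K H L \<tau> \<longrightarrow>
        (\<forall>X\<in>commuting_tuples H n. \<forall>Y\<in>commuting_tuples H n.
           value_at K H L \<tau> n A X = value_at K H L \<tau> n A Y))"

definition polynomial_of_degree_le ::
  "'k hspace \<Rightarrow> nat list \<Rightarrow> (nat list list \<Rightarrow> 'k \<Rightarrow> 'k) \<Rightarrow> nat \<Rightarrow> bool" where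
  "polynomial_of_degree_le K n A d \<longleftrightarrow>
     (\<forall>\<alpha>\<in>multiwords n. sum_list (map length \<alpha>) > d \<longrightarrow> A \<alpha> = \<zero>\<^bsub>bop K\<^esub>)"

text \<open>
  The universe of carriers used in the theorem is \<open>'u \<Rightarrow> complex\<close> for an arbitrary infinite type \<open>'u\<close>.
  It contains a copy of every Hilbert space of dimension at most the cardinality of \<open>'u\<close>, for instance
  as a space of square-summable families; in particular it contains all separable Hilbert spaces.
\<close>

type_synonym 'u universe = "'u \<Rightarrow> complex"

end

theory Submission
  imports Defs "HOL-Library.Sublist" "HOL-Library.Countable"
begin

text \<open>
  A coefficient of a free power series can be read off from the values of the series on a single
  family of operators.  Fix a multiword \<open>\<gamma>\<close> of total length \<open>N\<close>, and let \<open>H\<close> be the finite-dimensional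
  space with orthonormal basis \<open>e\<^sub>\<alpha>\<close>, where \<open>\<alpha>\<close> runs through the multiwords of total length at most
  \<open>N\<close>: the truncated Fock space.  The creation operators, which prepend one letter to one component of
  \<open>\<alpha>\<close> and send \<open>e\<^sub>\<alpha>\<close> to \<open>0\<close> if the result is too long, form a commuting tuple, because prepending
  letters to different components commutes.  Scale this tuple by \<open>r \<ge> 1\<close>.  The operator of the
  multiword \<open>\<alpha>\<close> is then \<open>r ^ |\<alpha>|\<close> times the operator of left concatenation with \<open>\<alpha>\<close>; it vanishes for
  \<open>|\<alpha>| > N\<close>, so that the series has only finitely many nonzero terms there and no question of
  convergence arises.  Applied to \<open>x \<otimes> e\<close> with the vacuum vector \<open>e\<close>, the basis vector of the empty
  multiword, the value of \<open>F\<close> is the sum of the vectors \<open>r ^ |\<alpha>| \<cdot> A\<^sub>\<alpha> x \<otimes> e\<^sub>\<alpha>\<close>.  Its coordinate at \<open>\<gamma>\<close>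
  (\<open>co_value_vacuum\<close>) gives \<open>r ^ |\<gamma>| \<cdot> \<parallel>A\<^sub>\<gamma> x\<parallel> \<le> \<parallel>F(X)\<parallel> \<cdot> \<parallel>x \<otimes> e\<parallel>\<close>.

  On the other side, the adjoint of a concatenation operator is a deletion operator, so
  \<open>X\<^sub>\<alpha> X\<^sub>\<alpha>\<^sup>*\<close> is \<open>r ^ (2|\<alpha>|)\<close> times a projection, and the sum over all \<open>\<alpha>\<close> with \<open>|\<alpha>\<^sub>i| = q\<^sub>i\<close> has norm
  \<open>O(r ^ (2|q|))\<close> (\<open>opnorm_row\<close>).  Hence a growth bound with exponent \<open>q\<close> yields
  \<open>r ^ |\<gamma>| \<cdot> \<parallel>A\<^sub>\<gamma> x\<parallel> = O(r ^ |q|)\<close>, which for \<open>|\<gamma>| > |q|\<close> forces \<open>A\<^sub>\<gamma> = 0\<close> as \<open>r\<close> grows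
  (\<open>coefficient_eq_zero\<close>).  A bounded function is the case of exponent \<open>0\<close>: all coefficients of nonempty
  multiwords vanish, and what remains does not depend on the point
  (\<open>constant_function_if_coefficients_zero\<close>).

  Most of the work goes into making these spaces concrete.  The tensor product of \<open>K\<close> with a
  space of coordinate families over a finite set \<open>B\<close> is the power \<open>K\<^sup>B\<close>, and \<open>H\<close> is
  itself such a power, of the complex numbers.  All operators that occur permute coordinates partially
  and act by one operator on each of them.  Products compose the permutations, adjoints invert them, and
  \<open>A \<otimes> T\<close> is obtained by changing the operator on the coordinates (\<open>op_tensor_cop\<close>).
\<close>

section \<open>Hilbert spaces and their bounded operators\<close>

lemma ring_of_type_algebra_simps [simp]:
  "carrier (ring_of_type_algebra :: complex ring) = UNIV"
  "a \<otimes>\<^bsub>(ring_of_type_algebra :: complex ring)\<^esub> b = a * b"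
  "a \<oplus>\<^bsub>(ring_of_type_algebra :: complex ring)\<^esub> b = a + b"
  "\<zero>\<^bsub>(ring_of_type_algebra :: complex ring)\<^esub> = 0"
  "\<one>\<^bsub>(ring_of_type_algebra :: complex ring)\<^esub> = 1"
  by (simp_all add: ring_of_type_algebra_def)

lemma additive_zero:
  assumes G: "abelian_group G" and G': "abelian_group G'"
    and h: "h \<in> carrier G \<rightarrow> carrier G'"
    and add: "\<And>x y. x \<in> carrier G \<Longrightarrow> y \<in> carrier G \<Longrightarrow> h (x \<oplus>\<^bsub>G\<^esub> y) = h x \<oplus>\<^bsub>G'\<^esub> h y"
  shows "h \<zero>\<^bsub>G\<^esub> = \<zero>\<^bsub>G'\<^esub>"
proof -
  interpret G: abelian_group G by fact
  interpret G': abelian_group G' by fact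
  have *: "h \<zero>\<^bsub>G\<^esub> \<in> carrier G'" using h by auto
  have "h \<zero>\<^bsub>G\<^esub> \<oplus>\<^bsub>G'\<^esub> h \<zero>\<^bsub>G\<^esub> = h \<zero>\<^bsub>G\<^esub>"
    using add[of "\<zero>\<^bsub>G\<^esub>" "\<zero>\<^bsub>G\<^esub>"] by simp
  then show ?thesis using * by (metis G'.add.r_cancel_one')
qed

lemma additive_finsum:
  assumes G: "abelian_group G" and G': "abelian_group G'"
    and h: "h \<in> carrier G \<rightarrow> carrier G'"
    and add: "\<And>x y. x \<in> carrier G \<Longrightarrow> y \<in> carrier G \<Longrightarrow> h (x \<oplus>\<^bsub>G\<^esub> y) = h x \<oplus>\<^bsub>G'\<^esub> h y"
    and f: "\<And>a. a \<in> S \<Longrightarrow> f a \<in> carrier G"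
  shows "h (\<Oplus>\<^bsub>G\<^esub>a\<in>S. f a) = (\<Oplus>\<^bsub>G'\<^esub>a\<in>S. h (f a))"
proof -
  interpret G: abelian_group G by fact
  interpret G': abelian_group G' by fact
  note zero = additive_zero[where h = h, OF G G' h add]
  show ?thesis
  proof (cases "finite S")
    case True
    then show ?thesis using f
    proof (induction S)
      case empty
      then show ?case using zero by simp
    next
      case (insert a S)
      have "f \<in> S \<rightarrow> carrier G" "(\<lambda>a. h (f a)) \<in> S \<rightarrow> carrier G'"
        using insert.prems h by auto
      with insert show ?case using h by (simp add: add Pi_iff)
    qed
  next
    case False
    then show ?thesis using zero by simp
  qed
qed

lemma additive_minus:
  assumes G: "abelian_group G" and G': "abelian_group G'"
    and h: "h \<in> carrier G \<rightarrow> carrier G'"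
    and add: "\<And>x y. x \<in> carrier G \<Longrightarrow> y \<in> carrier G \<Longrightarrow> h (x \<oplus>\<^bsub>G\<^esub> y) = h x \<oplus>\<^bsub>G'\<^esub> h y"
    and x: "x \<in> carrier G" and y: "y \<in> carrier G"
  shows "h (x \<ominus>\<^bsub>G\<^esub> y) = h x \<ominus>\<^bsub>G'\<^esub> h y"
proof -
  interpret G: abelian_group G by fact
  interpret G': abelian_group G' by fact
  have y': "\<ominus>\<^bsub>G\<^esub> y \<in> carrier G" "h y \<in> carrier G'" "h (\<ominus>\<^bsub>G\<^esub> y) \<in> carrier G'"
    using y h by auto
  have "h (\<ominus>\<^bsub>G\<^esub> y) \<oplus>\<^bsub>G'\<^esub> h y = \<zero>\<^bsub>G'\<^esub>"
    using add[OF y'(1) y] y additive_zero[where h = h, OF G G' h add] by (simp add: G.l_neg)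
  then have "h (\<ominus>\<^bsub>G\<^esub> y) = \<ominus>\<^bsub>G'\<^esub> h y"
    using y' by (metis G'.minus_equality)
  then show ?thesis
    using add[OF x y'(1)] by (simp add: a_minus_def)
qed

text \<open>The fold behind a finite sum evaluates the summands on the index set only, so termwise equality is enough even
  for terms outside the carrier.  This matters for sums of tensor products of operators on
  arbitrary Hilbert spaces, where two sums are compared termwise without knowing that the terms
  are bounded operators.\<close>

lemma finsum_cong_plain:
  assumes "\<And>a. a \<in> S \<Longrightarrow> f a = g a"
  shows "(\<Oplus>\<^bsub>G\<^esub>a\<in>S. f a) = (\<Oplus>\<^bsub>G\<^esub>a\<in>S. g a)"
proof -
  have "(S, y) \<in> foldSetD D (m \<circ> g) e"
    if "(S, y) \<in> foldSetD D (m \<circ> f) e" "\<And>a. a \<in> S \<Longrightarrow> f a = g a"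
    for f g :: "'a \<Rightarrow> 'b" and S y D e and m :: "'b \<Rightarrow> 'b \<Rightarrow> 'b"
    using that
  proof (induction rule: foldSetD.induct)
    case emptyI
    then show ?case by (simp only: foldSetD.emptyI)
  next
    case (insertI x A y)
    then have "m (f x) y = (m \<circ> g) x y" by simp
    with insertI show ?case
      by (metis comp_apply foldSetD.insertI insert_iff)
  qed
  from this[of S _ _ "add G" f _ g] this[of S _ _ "add G" g _ f] assms
  have "(S, y) \<in> foldSetD D (add G \<circ> f) e \<longleftrightarrow> (S, y) \<in> foldSetD D (add G \<circ> g) e"
    for y D e by auto
  then show ?thesis
    unfolding finsum_def finprod_def foldD_def by simp
qed

lemma double_sum_squares_le:
  fixes a b :: real
  assumes "0 \<le> a" "0 \<le> b"
  shows "2 * a\<^sup>2 + 2 * b\<^sup>2 \<le> (2 * (a + b))\<^sup>2"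
proof -
  have "(2 * (a + b))\<^sup>2 = (2 * a\<^sup>2 + 2 * b\<^sup>2) + (2 * a\<^sup>2 + 2 * b\<^sup>2 + 8 * (a * b))"
    by (simp add: power2_sum power_mult_distrib)
  moreover have "0 \<le> 2 * a\<^sup>2 + 2 * b\<^sup>2 + 8 * (a * b)" using assms by simp
  ultimately show ?thesis by linarith
qed

context hilbert_space begin

lemma smult_in [simp, intro]: "x \<in> carrier H \<Longrightarrow> c \<odot> x \<in> carrier H"
  by simp

lemma hinner_add_right:
  assumes "x \<in> carrier H" "y \<in> carrier H" "z \<in> carrier H"
  shows "hinner H x (y \<oplus> z) = hinner H x y + hinner H x z"
  using assms hinner_commute[of "y \<oplus> z" x] hinner_commute[of y x] hinner_commute[of z x]
  by (simp add: hinner_add)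

lemma hinner_smult_right:
  assumes "x \<in> carrier H" "y \<in> carrier H"
  shows "hinner H x (c \<odot> y) = cnj c * hinner H x y"
  using assms hinner_commute[of "c \<odot> y" x] hinner_commute[of y x]
  by (simp add: hinner_smult)

lemma minus_eq_smult: "x \<in> carrier H \<Longrightarrow> \<ominus> x = (- 1) \<odot> x"
proof -
  assume x: "x \<in> carrier H"
  have "(- 1) \<odot> x \<oplus> x = (- 1 + 1) \<odot> x"
    using smult_l_distr[of "-1" 1 x] smult_one x by simp
  also have "\<dots> = \<zero>" using smult_l_null[OF x] by simp
  finally show ?thesis using x by (simp add: M.minus_equality)
qed

lemma hinner_zero_left: "x \<in> carrier H \<Longrightarrow> hinner H \<zero> x = 0"
  using hinner_smult[of x x 0] smult_l_null[of x] by simp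

lemma hinner_self_nonneg: "x \<in> carrier H \<Longrightarrow> 0 \<le> Re (hinner H x x)"
  using hinner_pos[of x] hinner_zero_left[of x] by (cases "x = \<zero>") auto

lemma hnorm_square: "x \<in> carrier H \<Longrightarrow> (hnorm H x)\<^sup>2 = Re (hinner H x x)"
  by (simp add: hnorm_def hinner_self_nonneg)

lemma hnorm_nonneg: "x \<in> carrier H \<Longrightarrow> 0 \<le> hnorm H x"
  by (simp add: hnorm_def hinner_self_nonneg)

lemma hnorm_zero: "hnorm H \<zero> = 0"
  by (simp add: hnorm_def hinner_zero_left)

lemma hnorm_eq_0_iff: "x \<in> carrier H \<Longrightarrow> hnorm H x = 0 \<longleftrightarrow> x = \<zero>"
  using hinner_pos[of x] hinner_zero_left[of \<zero>]
  by (cases "x = \<zero>") (auto simp: hnorm_def)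

lemma right_minus_eq_iff:
  assumes "x \<in> carrier H" "y \<in> carrier H"
  shows "x \<ominus> y = \<zero> \<longleftrightarrow> x = y"
proof
  assume "x \<ominus> y = \<zero>"
  then have "(x \<ominus> y) \<oplus> y = y" using assms by simp
  then show "x = y" using assms by (simp add: a_minus_def M.a_assoc M.l_neg)
qed (use assms in \<open>simp add: a_minus_def M.r_neg\<close>)

text \<open>The difference of the two vectors is orthogonal to every vector, hence to itself.\<close>

lemma hinner_ext:
  assumes x: "x \<in> carrier H" and y: "y \<in> carrier H"
    and eq: "\<And>z. z \<in> carrier H \<Longrightarrow> hinner H z x = hinner H z y"
  shows "x = y"
proof -
  have z: "x \<ominus> y \<in> carrier H" using x y by simp
  have "hinner H z (x \<ominus> y) = 0" if "z \<in> carrier H" for z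
    using that x y eq[of z] unfolding a_minus_def minus_eq_smult[OF y]
    by (simp add: hinner_add_right hinner_smult_right)
  from this[OF z] have "Re (hinner H (x \<ominus> y) (x \<ominus> y)) = 0" by simp
  then have "x \<ominus> y = \<zero>" using hinner_pos[OF z] by (metis less_irrefl)
  then show ?thesis using x y by (simp add: right_minus_eq_iff)
qed

lemma hnorm_smult: "x \<in> carrier H \<Longrightarrow> hnorm H (c \<odot> x) = cmod c * hnorm H x"
proof -
  assume x: "x \<in> carrier H"
  have "hinner H (c \<odot> x) (c \<odot> x) = (c * cnj c) * hinner H x x"
    using x by (simp add: hinner_smult hinner_smult_right)
  then have "Re (hinner H (c \<odot> x) (c \<odot> x)) = (cmod c)\<^sup>2 * Re (hinner H x x)"
    unfolding complex_norm_square[symmetric] by simp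
  then show ?thesis
    by (simp add: hnorm_def real_sqrt_mult)
qed

text \<open>The parallelogram law gives the triangle inequality up to a factor, which is all that
  boundedness of sums of operators asks for.\<close>

lemma hnorm_add_le:
  assumes x: "x \<in> carrier H" and y: "y \<in> carrier H"
  shows "hnorm H (x \<oplus> y) \<le> 2 * (hnorm H x + hnorm H y)"
proof -
  define z where "z = (-1) \<odot> y"
  have z: "z \<in> carrier H" "hinner H z w = - hinner H y w" "hinner H w z = - hinner H w y"
    if "w \<in> carrier H" for w
    using y that hinner_smult[OF y that, of "-1"] hinner_smult_right[OF that y, of "-1"]
    by (auto simp: z_def)
  note z' = z[OF x] z[OF y] z[OF z(1)[OF x]]
  have xy: "x \<oplus> y \<in> carrier H" "x \<oplus> z \<in> carrier H" using x y z'(1) by auto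
  have "hinner H (x \<oplus> y) (x \<oplus> y) + hinner H (x \<oplus> z) (x \<oplus> z)
      = 2 * hinner H x x + 2 * hinner H y y"
    using x y xy z' by (simp only: hinner_add hinner_add_right) simp
  then have "Re (hinner H (x \<oplus> y) (x \<oplus> y)) + Re (hinner H (x \<oplus> z) (x \<oplus> z))
      = 2 * Re (hinner H x x) + 2 * Re (hinner H y y)"
    by (metis plus_complex.simps(1) mult_2)
  then have "(hnorm H (x \<oplus> y))\<^sup>2 \<le> 2 * (hnorm H x)\<^sup>2 + 2 * (hnorm H y)\<^sup>2"
    using hinner_self_nonneg[OF xy(2)]
    unfolding hnorm_square[OF x] hnorm_square[OF y] hnorm_square[OF xy(1)] by linarith
  also have "\<dots> \<le> (2 * (hnorm H x + hnorm H y))\<^sup>2"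
    using hnorm_nonneg[OF x] hnorm_nonneg[OF y] by (rule double_sum_squares_le)
  finally show ?thesis
    by (rule power2_le_imp_le) (use hnorm_nonneg[OF x] hnorm_nonneg[OF y] in simp)
qed

lemma bopI:
  assumes "\<And>x. x \<in> carrier H \<Longrightarrow> T x \<in> carrier H"
    and "\<And>x y. x \<in> carrier H \<Longrightarrow> y \<in> carrier H \<Longrightarrow> T (x \<oplus> y) = T x \<oplus> T y"
    and "\<And>c x. x \<in> carrier H \<Longrightarrow> T (c \<odot> x) = c \<odot> T x"
    and "\<And>x. x \<in> carrier H \<Longrightarrow> hnorm H (T x) \<le> M * hnorm H x"
    and "T \<in> extensional (carrier H)"
  shows "T \<in> carrier (bop H)"
  using assms unfolding bop_def PiE_def by (auto intro!: exI[of _ M])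

lemma bop_closed: "T \<in> carrier (bop H) \<Longrightarrow> x \<in> carrier H \<Longrightarrow> T x \<in> carrier H"
  by (auto simp: bop_def)

lemma bop_add: "T \<in> carrier (bop H) \<Longrightarrow> x \<in> carrier H \<Longrightarrow> y \<in> carrier H
    \<Longrightarrow> T (x \<oplus> y) = T x \<oplus> T y"
  by (auto simp: bop_def)

lemma bop_smult: "T \<in> carrier (bop H) \<Longrightarrow> x \<in> carrier H \<Longrightarrow> T (c \<odot> x) = c \<odot> T x"
  by (auto simp: bop_def)

lemma bop_bounded:
  assumes "T \<in> carrier (bop H)"
  shows "\<exists>M\<ge>0. \<forall>x\<in>carrier H. hnorm H (T x) \<le> M * hnorm H x"
proof -
  from assms obtain M where M: "\<forall>x\<in>carrier H. hnorm H (T x) \<le> M * hnorm H x"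
    by (auto simp: bop_def)
  have "hnorm H (T x) \<le> \<bar>M\<bar> * hnorm H x" if "x \<in> carrier H" for x
    using M that mult_right_mono[OF abs_ge_self hnorm_nonneg[OF that], of M] by force
  then show ?thesis by (intro exI[of _ "\<bar>M\<bar>"]) auto
qed

lemma bop_extensional: "T \<in> carrier (bop H) \<Longrightarrow> T \<in> extensional (carrier H)"
  by (auto simp: bop_def PiE_def)

lemma bop_ext:
  assumes "S \<in> carrier (bop H)" "T \<in> carrier (bop H)"
    and "\<And>x. x \<in> carrier H \<Longrightarrow> S x = T x"
  shows "S = T"
  using assms bop_extensional extensionalityI by blast

lemma bop_zero_image: "T \<in> carrier (bop H) \<Longrightarrow> T \<zero> = \<zero>"
  using bop_smult[of T \<zero> 0] bop_closed[of T \<zero>] smult_l_null by simp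

lemma bop_apply_simps:
  "x \<in> carrier H \<Longrightarrow> \<zero>\<^bsub>bop H\<^esub> x = \<zero>"
  "x \<in> carrier H \<Longrightarrow> \<one>\<^bsub>bop H\<^esub> x = x"
  "x \<in> carrier H \<Longrightarrow> (S \<oplus>\<^bsub>bop H\<^esub> T) x = S x \<oplus> T x"
  "x \<in> carrier H \<Longrightarrow> (S \<otimes>\<^bsub>bop H\<^esub> T) x = S (T x)"
  by (simp_all add: bop_def compose_def)

lemma one_in_bop: "\<one>\<^bsub>bop H\<^esub> \<in> carrier (bop H)"
  by (rule bopI[where M = 1]) (auto simp: bop_def)

lemma mult_in_bop:
  assumes S: "S \<in> carrier (bop H)" and T: "T \<in> carrier (bop H)"
  shows "S \<otimes>\<^bsub>bop H\<^esub> T \<in> carrier (bop H)"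
proof -
  obtain M where M: "0 \<le> M" "\<And>x. x \<in> carrier H \<Longrightarrow> hnorm H (S x) \<le> M * hnorm H x"
    using bop_bounded[OF S] by blast
  obtain N where N: "0 \<le> N" "\<And>x. x \<in> carrier H \<Longrightarrow> hnorm H (T x) \<le> N * hnorm H x"
    using bop_bounded[OF T] by blast
  show ?thesis
  proof (rule bopI[where M = "M * N"])
    show "S \<otimes>\<^bsub>bop H\<^esub> T \<in> extensional (carrier H)"
      by (simp add: bop_def compose_def)
    fix x assume x: "x \<in> carrier H"
    then have "hnorm H (S (T x)) \<le> M * hnorm H (T x)"
      using M bop_closed[OF T] by blast
    also have "\<dots> \<le> M * (N * hnorm H x)"
      using M N x mult_left_mono by blast
    finally show "hnorm H ((S \<otimes>\<^bsub>bop H\<^esub> T) x) \<le> M * N * hnorm H x"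
      using x by (simp add: bop_apply_simps)
  qed (use S T in \<open>simp_all add: bop_apply_simps bop_closed bop_add bop_smult\<close>)
qed

lemma abelian_group_bop: "abelian_group (bop H)"
proof (rule abelian_groupI)
  fix S T assume S: "S \<in> carrier (bop H)" and T: "T \<in> carrier (bop H)"
  obtain M where M: "0 \<le> M" "\<And>x. x \<in> carrier H \<Longrightarrow> hnorm H (S x) \<le> M * hnorm H x"
    using bop_bounded[OF S] by blast
  obtain N where N: "0 \<le> N" "\<And>x. x \<in> carrier H \<Longrightarrow> hnorm H (T x) \<le> N * hnorm H x"
    using bop_bounded[OF T] by blast
  show "S \<oplus>\<^bsub>bop H\<^esub> T \<in> carrier (bop H)"
  proof (rule bopI[where M = "2 * (M + N)"])
    show "S \<oplus>\<^bsub>bop H\<^esub> T \<in> extensional (carrier H)"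
      by (simp add: bop_def)
    fix x assume x: "x \<in> carrier H"
    show "hnorm H ((S \<oplus>\<^bsub>bop H\<^esub> T) x) \<le> 2 * (M + N) * hnorm H x"
      using x M(2)[OF x] N(2)[OF x] hnorm_add_le[of "S x" "T x"] S T
      by (simp add: bop_apply_simps bop_closed algebra_simps)
  next
    fix x y assume x: "x \<in> carrier H" and y: "y \<in> carrier H"
    show "(S \<oplus>\<^bsub>bop H\<^esub> T) (x \<oplus> y) = (S \<oplus>\<^bsub>bop H\<^esub> T) x \<oplus> (S \<oplus>\<^bsub>bop H\<^esub> T) y"
      using x y S T by (simp add: bop_apply_simps bop_closed bop_add M.a_ac)
  qed (use S T in \<open>simp_all add: bop_apply_simps bop_closed bop_smult smult_r_distr\<close>)
  show "S \<oplus>\<^bsub>bop H\<^esub> T = T \<oplus>\<^bsub>bop H\<^esub> S"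
    using S T by (auto simp: bop_def intro!: ext M.a_comm)
next
  show "\<zero>\<^bsub>bop H\<^esub> \<in> carrier (bop H)"
    by (rule bopI[where M = 0]) (auto simp: bop_def hnorm_zero)
next
  fix S T U assume "S \<in> carrier (bop H)" "T \<in> carrier (bop H)" "U \<in> carrier (bop H)"
  then show "S \<oplus>\<^bsub>bop H\<^esub> T \<oplus>\<^bsub>bop H\<^esub> U = S \<oplus>\<^bsub>bop H\<^esub> (T \<oplus>\<^bsub>bop H\<^esub> U)"
    by (auto simp: bop_def intro!: ext M.a_assoc)
next
  fix T assume T: "T \<in> carrier (bop H)"
  show "\<zero>\<^bsub>bop H\<^esub> \<oplus>\<^bsub>bop H\<^esub> T = T"
    using bop_closed[OF T] bop_extensional[OF T]
    by (auto simp: bop_def extensional_def)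
  obtain M where M: "0 \<le> M" "\<And>x. x \<in> carrier H \<Longrightarrow> hnorm H (T x) \<le> M * hnorm H x"
    using bop_bounded[OF T] by blast
  let ?S = "\<lambda>x\<in>carrier H. \<ominus> T x"
  have "?S \<in> carrier (bop H)"
  proof (rule bopI[where M = M])
    fix x assume "x \<in> carrier H"
    then show "hnorm H (?S x) \<le> M * hnorm H x"
      using M(2)[of x] by (simp add: minus_eq_smult bop_closed[OF T] hnorm_smult)
  next
    fix x c assume x: "x \<in> carrier H"
    then show "?S (c \<odot> x) = c \<odot> ?S x"
      using smult_assoc1[of "- 1" c "T x"] smult_assoc1[of c "- 1" "T x"]
      by (simp add: bop_smult[OF T] minus_eq_smult bop_closed[OF T])
  qed (use T in \<open>simp_all add: bop_closed bop_add M.minus_add\<close>)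
  moreover have "?S \<oplus>\<^bsub>bop H\<^esub> T = \<zero>\<^bsub>bop H\<^esub>"
    using bop_closed[OF T] by (auto simp: bop_def M.l_neg)
  ultimately show "\<exists>S\<in>carrier (bop H). S \<oplus>\<^bsub>bop H\<^esub> T = \<zero>\<^bsub>bop H\<^esub>" by blast
qed

lemma additive_apply:
  assumes "x \<in> carrier H"
  shows "(\<lambda>T. T x) \<in> carrier (bop H) \<rightarrow> carrier H"
    "(S \<oplus>\<^bsub>bop H\<^esub> T) x = S x \<oplus> T x"
  using assms by (auto simp: bop_closed bop_apply_simps)

lemma finsum_apply:
  assumes "x \<in> carrier H" "\<And>a. a \<in> S \<Longrightarrow> f a \<in> carrier (bop H)"
  shows "(\<Oplus>\<^bsub>bop H\<^esub>a\<in>S. f a) x = (\<Oplus>a\<in>S. f a x)"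
  by (rule additive_finsum[OF abelian_group_bop M.abelian_group_axioms, where h = "\<lambda>T. T x"])
    (simp_all add: additive_apply[OF assms(1)] assms)

lemma minus_apply:
  assumes "x \<in> carrier H" "S \<in> carrier (bop H)" "T \<in> carrier (bop H)"
  shows "(S \<ominus>\<^bsub>bop H\<^esub> T) x = S x \<ominus> T x"
  by (rule additive_minus[OF abelian_group_bop M.abelian_group_axioms, where h = "\<lambda>T. T x"])
    (simp_all add: additive_apply[OF assms(1)] assms)

text \<open>The supremum in the definition of the operator norm is a real one, so the boundedness of the operator
  also has to supply the upper bound that makes the supremum meaningful; scaling to norm one does the rest.\<close>

lemma hnorm_le_opnorm:
  assumes T: "T \<in> carrier (bop H)" and x: "x \<in> carrier H"
  shows "hnorm H (T x) \<le> opnorm H T * hnorm H x"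
proof (cases "x = \<zero>")
  case True
  then show ?thesis by (simp add: bop_zero_image[OF T] hnorm_zero)
next
  case False
  then have pos: "0 < hnorm H x"
    using x hnorm_nonneg[OF x] hnorm_eq_0_iff[OF x] by linarith
  obtain M where M: "0 \<le> M" "\<And>x. x \<in> carrier H \<Longrightarrow> hnorm H (T x) \<le> M * hnorm H x"
    using bop_bounded[OF T] by blast
  define c where "c = complex_of_real (1 / hnorm H x)"
  have "bdd_above ((\<lambda>x. hnorm H (T x)) ` {x \<in> carrier H. hnorm H x \<le> 1})"
  proof (rule bdd_aboveI2)
    fix x assume "x \<in> {x \<in> carrier H. hnorm H x \<le> 1}"
    then show "hnorm H (T x) \<le> M"
      using M(2)[of x] mult_left_mono[of "hnorm H x" 1 M] M(1) by auto
  qed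
  moreover have "c \<odot> x \<in> {x \<in> carrier H. hnorm H x \<le> 1}"
    using x pos by (simp add: hnorm_smult c_def norm_divide)
  ultimately have "hnorm H (T (c \<odot> x)) \<le> opnorm H T"
    unfolding opnorm_def by (rule cSUP_upper[rotated])
  then show ?thesis
    using x pos T by (simp add: bop_smult bop_closed hnorm_smult c_def norm_divide field_simps)
qed

lemma opnorm_le:
  assumes "0 \<le> M" "\<And>x. x \<in> carrier H \<Longrightarrow> hnorm H (T x) \<le> M * hnorm H x"
  shows "opnorm H T \<le> M"
  unfolding opnorm_def
proof (rule cSUP_least)
  show "{x \<in> carrier H. hnorm H x \<le> 1} \<noteq> {}"
    using M.zero_closed hnorm_zero by force
  fix x assume "x \<in> {x \<in> carrier H. hnorm H x \<le> 1}"
  then show "hnorm H (T x) \<le> M"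
    using assms(2)[of x] mult_left_mono[of "hnorm H x" 1 M] assms(1) by auto
qed

lemma opnorm_zero: "opnorm H \<zero>\<^bsub>bop H\<^esub> = 0"
proof -
  have "opnorm H \<zero>\<^bsub>bop H\<^esub> = (SUP x\<in>{x \<in> carrier H. hnorm H x \<le> 1}. (0::real))"
    unfolding opnorm_def by (intro SUP_cong) (auto simp: bop_apply_simps hnorm_zero)
  moreover have "\<zero> \<in> {x \<in> carrier H. hnorm H x \<le> 1}"
    using hnorm_zero by simp
  ultimately show ?thesis by (metis cSUP_const empty_iff)
qed

lemma opnorm_diff_eq_0:
  assumes "S \<in> carrier (bop H)" "T \<in> carrier (bop H)" "opnorm H (S \<ominus>\<^bsub>bop H\<^esub> T) = 0"
  shows "S = T"
proof (rule bop_ext[OF assms(1,2)])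
  interpret B: abelian_group "bop H" by (rule abelian_group_bop)
  fix x assume x: "x \<in> carrier H"
  have "hnorm H ((S \<ominus>\<^bsub>bop H\<^esub> T) x) \<le> 0"
    using hnorm_le_opnorm[of "S \<ominus>\<^bsub>bop H\<^esub> T" x] assms x by simp
  then have "(S \<ominus>\<^bsub>bop H\<^esub> T) x = \<zero>"
    using hnorm_eq_0_iff hnorm_nonneg bop_closed[of "S \<ominus>\<^bsub>bop H\<^esub> T" x] assms x
    by (metis B.minus_closed antisym)
  then show "S x = T x"
    using x assms by (simp add: minus_apply bop_closed right_minus_eq_iff)
qed

lemma adj_eqI:
  assumes "T \<in> carrier (bop H)" "S \<in> carrier (bop H)"
    and "\<And>x y. x \<in> carrier H \<Longrightarrow> y \<in> carrier H \<Longrightarrow> hinner H (T x) y = hinner H x (S y)"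
  shows "adj H T = S"
  unfolding adj_def
proof (rule the_equality)
  fix S' assume S': "S' \<in> carrier (bop H) \<and>
    (\<forall>x\<in>carrier H. \<forall>y\<in>carrier H. hinner H (T x) y = hinner H x (S' y))"
  then have S'_bop: "S' \<in> carrier (bop H)" by simp
  show "S' = S"
  proof (rule bop_ext[OF S'_bop assms(2)])
    fix y assume y: "y \<in> carrier H"
    show "S' y = S y"
    proof (rule hinner_ext)
      fix x assume x: "x \<in> carrier H"
      show "hinner H x (S' y) = hinner H x (S y)"
        using S' assms(3)[OF x y] x y by metis
    qed (use S'_bop assms(2) y bop_closed in auto)
  qed
qed (use assms in auto)

end

section \<open>Finite powers of a Hilbert space\<close>

text \<open>The Hilbert space \<open>K\<^sup>B\<close> of families indexed by a finite set \<open>B\<close>.  Since Hilbert spaces are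
  required to live in prescribed types, a family \<open>f\<close> is represented by \<open>J f\<close> for an injection \<open>J\<close> into
  the type at hand, and \<open>coord\<close> recovers the family.\<close>

definition coord :: "(('i \<Rightarrow> 'a) \<Rightarrow> 'b) \<Rightarrow> 'i set \<Rightarrow> 'a hspace \<Rightarrow> 'b \<Rightarrow> 'i \<Rightarrow> 'a" where
  "coord J B K = inv_into (B \<rightarrow>\<^sub>E carrier K) J"

definition hpower :: "(('i \<Rightarrow> 'a) \<Rightarrow> 'b) \<Rightarrow> 'i set \<Rightarrow> 'a hspace \<Rightarrow> 'b hspace" where
  "hpower J B K = \<lparr>
     carrier = J ` (B \<rightarrow>\<^sub>E carrier K),
     monoid.mult = undefined,
     one = undefined,
     ring.zero = J (\<lambda>b\<in>B. \<zero>\<^bsub>K\<^esub>),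
     add = (\<lambda>z w. J (\<lambda>b\<in>B. coord J B K z b \<oplus>\<^bsub>K\<^esub> coord J B K w b)),
     module.smult = (\<lambda>c z. J (\<lambda>b\<in>B. c \<odot>\<^bsub>K\<^esub> coord J B K z b)),
     hinner = (\<lambda>z w. \<Sum>b\<in>B. hinner K (coord J B K z b) (coord J B K w b))\<rparr>"

locale hilbert_power = hilbert_space K for K :: "'a hspace" (structure) +
  fixes J :: "('i \<Rightarrow> 'a) \<Rightarrow> 'b" and B :: "'i set"
  assumes finite_B: "finite B" and inj_J: "inj_on J (B \<rightarrow>\<^sub>E carrier K)"
begin

abbreviation "V \<equiv> hpower J B K"
abbreviation "co \<equiv> coord J B K"

lemma co_J: "f \<in> B \<rightarrow>\<^sub>E carrier K \<Longrightarrow> co (J f) = f"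
  using inj_J by (simp add: coord_def)

lemma J_in: "f \<in> B \<rightarrow>\<^sub>E carrier K \<Longrightarrow> J f \<in> carrier V"
  by (simp add: hpower_def)

lemma co_PiE: "z \<in> carrier V \<Longrightarrow> co z \<in> B \<rightarrow>\<^sub>E carrier K"
  using co_J by (auto simp: hpower_def)

lemma co_in: "z \<in> carrier V \<Longrightarrow> b \<in> B \<Longrightarrow> co z b \<in> carrier K"
  using co_PiE by blast

lemma J_restrict_in:
  assumes "\<And>b. b \<in> B \<Longrightarrow> f b \<in> carrier K"
  shows "J (\<lambda>b\<in>B. f b) \<in> carrier V"
  by (rule J_in) (use assms in auto)

lemma co_J_restrict:
  assumes "\<And>b. b \<in> B \<Longrightarrow> f b \<in> carrier K" "b \<in> B"
  shows "co (J (\<lambda>b\<in>B. f b)) b = f b"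
proof -
  have "(\<lambda>b\<in>B. f b) \<in> B \<rightarrow>\<^sub>E carrier K" using assms by auto
  from co_J[OF this] show ?thesis using assms by simp
qed

lemma co_ext:
  assumes z: "z \<in> carrier V" and w: "w \<in> carrier V"
    and eq: "\<And>b. b \<in> B \<Longrightarrow> co z b = co w b"
  shows "z = w"
proof -
  have "co z = co w"
    using co_PiE[OF z] co_PiE[OF w] eq by (rule PiE_ext)
  moreover have "J (co z) = z" "J (co w) = w"
    using z w co_J by (auto simp: hpower_def)
  ultimately show ?thesis by metis
qed

lemma power_closed:
  "\<zero>\<^bsub>V\<^esub> \<in> carrier V"
  "z \<in> carrier V \<Longrightarrow> w \<in> carrier V \<Longrightarrow> z \<oplus>\<^bsub>V\<^esub> w \<in> carrier V"
  "z \<in> carrier V \<Longrightarrow> c \<odot>\<^bsub>V\<^esub> z \<in> carrier V"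
  using J_restrict_in[of "\<lambda>b. \<zero>"] J_restrict_in[of "\<lambda>b. co z b \<oplus> co w b"]
    J_restrict_in[of "\<lambda>b. c \<odot> co z b"] co_in
  by (auto simp: hpower_def)

lemma co_zero: "b \<in> B \<Longrightarrow> co \<zero>\<^bsub>V\<^esub> b = \<zero>"
  using co_J_restrict[of "\<lambda>b. \<zero>"] by (simp add: hpower_def)

lemma co_add:
  assumes "z \<in> carrier V" "w \<in> carrier V" "b \<in> B"
  shows "co (z \<oplus>\<^bsub>V\<^esub> w) b = co z b \<oplus> co w b"
  using co_J_restrict[of "\<lambda>b. co z b \<oplus> co w b"] co_in assms by (simp add: hpower_def)

lemma co_smult:
  assumes "z \<in> carrier V" "b \<in> B"
  shows "co (c \<odot>\<^bsub>V\<^esub> z) b = c \<odot> co z b"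
  using co_J_restrict[of "\<lambda>b. c \<odot> co z b"] co_in assms by (simp add: hpower_def)

lemma hinner_power: "hinner V z w = (\<Sum>b\<in>B. hinner K (co z b) (co w b))"
  by (simp add: hpower_def)

lemma abelian_group_power: "abelian_group V"
proof (rule abelian_groupI)
  fix z assume z: "z \<in> carrier V"
  have "(-1) \<odot>\<^bsub>V\<^esub> z \<oplus>\<^bsub>V\<^esub> z = \<zero>\<^bsub>V\<^esub>"
    using z by (intro co_ext)
      (auto simp: co_add co_smult co_zero power_closed co_in minus_eq_smult[symmetric] M.l_neg)
  then show "\<exists>w\<in>carrier V. w \<oplus>\<^bsub>V\<^esub> z = \<zero>\<^bsub>V\<^esub>"
    using z power_closed by blast
qed (auto intro!: co_ext simp: co_add co_zero power_closed co_in M.a_ac)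

lemma module_power: "module (ring_of_type_algebra :: complex ring) V"
proof (rule moduleI)
  show "cring (ring_of_type_algebra :: complex ring)" by (rule cring_from_type_algebra)
  fix a b :: complex and z assume z: "z \<in> carrier V"
  show "(a \<oplus>\<^bsub>ring_of_type_algebra\<^esub> b) \<odot>\<^bsub>V\<^esub> z = a \<odot>\<^bsub>V\<^esub> z \<oplus>\<^bsub>V\<^esub> b \<odot>\<^bsub>V\<^esub> z"
    by (intro co_ext)
      (use z smult_l_distr in \<open>auto simp: co_add co_smult power_closed co_in\<close>)
  show "(a \<otimes>\<^bsub>ring_of_type_algebra\<^esub> b) \<odot>\<^bsub>V\<^esub> z = a \<odot>\<^bsub>V\<^esub> (b \<odot>\<^bsub>V\<^esub> z)"
    by (intro co_ext)
      (use z smult_assoc1 in \<open>auto simp: co_add co_smult power_closed co_in\<close>)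
  show "\<one>\<^bsub>ring_of_type_algebra :: complex ring\<^esub> \<odot>\<^bsub>V\<^esub> z = z"
    by (intro co_ext)
      (use z smult_one in \<open>auto simp: co_add co_smult power_closed co_in\<close>)
  fix w assume w: "w \<in> carrier V"
  show "a \<odot>\<^bsub>V\<^esub> (z \<oplus>\<^bsub>V\<^esub> w) = a \<odot>\<^bsub>V\<^esub> z \<oplus>\<^bsub>V\<^esub> a \<odot>\<^bsub>V\<^esub> w"
    by (intro co_ext)
      (use z w smult_r_distr in \<open>auto simp: co_add co_smult power_closed co_in\<close>)
qed (auto simp: power_closed abelian_group_power)

lemma co_minus:
  assumes "z \<in> carrier V" "w \<in> carrier V" "b \<in> B"
  shows "co (z \<ominus>\<^bsub>V\<^esub> w) b = co z b \<ominus> co w b"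
  by (rule additive_minus[OF abelian_group_power M.abelian_group_axioms, where h = "\<lambda>z. co z b"])
    (use assms in \<open>auto simp: co_in co_add\<close>)

lemma co_finsum:
  assumes "\<And>a. a \<in> S \<Longrightarrow> f a \<in> carrier V" "b \<in> B"
  shows "co (\<Oplus>\<^bsub>V\<^esub>a\<in>S. f a) b = (\<Oplus>a\<in>S. co (f a) b)"
  by (rule additive_finsum[OF abelian_group_power M.abelian_group_axioms, where h = "\<lambda>z. co z b"])
    (use assms in \<open>auto simp: co_in co_add\<close>)

lemma Re_hinner_power:
  assumes "z \<in> carrier V"
  shows "Re (hinner V z z) = (\<Sum>b\<in>B. (hnorm K (co z b))\<^sup>2)"
  using assms by (simp add: hinner_power hnorm_square co_in)

lemma hnorm_power:
  "z \<in> carrier V \<Longrightarrow> hnorm V z = sqrt (\<Sum>b\<in>B. (hnorm K (co z b))\<^sup>2)"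
  by (simp add: hnorm_def[of V] Re_hinner_power)

lemma hnorm_co_le:
  assumes "z \<in> carrier V" "b \<in> B"
  shows "hnorm K (co z b) \<le> hnorm V z"
  unfolding hnorm_power[OF assms(1)]
proof (rule real_le_rsqrt)
  show "(hnorm K (co z b))\<^sup>2 \<le> (\<Sum>b\<in>B. (hnorm K (co z b))\<^sup>2)"
    using assms(2) finite_B by (intro member_le_sum) auto
qed

text \<open>Completeness holds because a Cauchy sequence is Cauchy in each of the finitely many coordinates.\<close>

lemma hilbert_space_power: "hilbert_space V"
proof -
  interpret V: module "ring_of_type_algebra :: complex ring" V by (rule module_power)
  show ?thesis
  proof unfold_locales
    fix z w u assume z: "z \<in> carrier V" and w: "w \<in> carrier V"
    show "hinner V (c \<odot>\<^bsub>V\<^esub> z) w = c * hinner V z w" for c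
      using z w by (simp add: hinner_power co_smult co_in hinner_smult sum_distrib_left)
    show "hinner V w z = cnj (hinner V z w)"
      using z w by (auto simp: hinner_power intro!: sum.cong hinner_commute co_in)
    assume u: "u \<in> carrier V"
    show "hinner V (z \<oplus>\<^bsub>V\<^esub> w) u = hinner V z u + hinner V w u"
      using z w u by (simp add: hinner_power co_add co_in hinner_add sum.distrib)
  next
    fix z assume z: "z \<in> carrier V" and "z \<noteq> \<zero>\<^bsub>V\<^esub>"
    then obtain b where b: "b \<in> B" "co z b \<noteq> \<zero>"
      using co_ext[OF z power_closed(1)] co_zero by metis
    then have "0 < (hnorm K (co z b))\<^sup>2"
      using z hnorm_eq_0_iff[of "co z b"] co_in by simp
    also have "\<dots> \<le> (\<Sum>b\<in>B. (hnorm K (co z b))\<^sup>2)"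
      using b finite_B by (intro member_le_sum) auto
    finally show "0 < Re (hinner V z z)" using z by (simp add: Re_hinner_power)
  next
    fix s :: "nat \<Rightarrow> 'b"
    assume s: "\<And>m. s m \<in> carrier V"
      and cauchy: "\<forall>e>0. \<exists>N. \<forall>m\<ge>N. \<forall>l\<ge>N. hnorm V (s m \<ominus>\<^bsub>V\<^esub> s l) < e"
    have "\<exists>x\<in>carrier K. (\<lambda>m. hnorm K (co (s m) b \<ominus> x)) \<longlonglongrightarrow> 0" if b: "b \<in> B" for b
    proof (rule complete)
      show "co (s m) b \<in> carrier K" for m using s b co_in by blast
      have "hnorm K (co (s m) b \<ominus> co (s l) b) \<le> hnorm V (s m \<ominus>\<^bsub>V\<^esub> s l)" for m l
        using hnorm_co_le[of "s m \<ominus>\<^bsub>V\<^esub> s l" b] s b V.M.minus_closed by (simp add: co_minus)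
      then show "\<forall>e>0. \<exists>N. \<forall>m\<ge>N. \<forall>l\<ge>N. hnorm K (co (s m) b \<ominus> co (s l) b) < e"
        using cauchy by (meson le_less_trans)
    qed
    then obtain x where x: "\<And>b. b \<in> B \<Longrightarrow> x b \<in> carrier K"
      and lim: "\<And>b. b \<in> B \<Longrightarrow> (\<lambda>m. hnorm K (co (s m) b \<ominus> x b)) \<longlonglongrightarrow> 0"
      by metis
    define w where "w = J (\<lambda>b\<in>B. x b)"
    have w: "w \<in> carrier V" "\<And>b. b \<in> B \<Longrightarrow> co w b = x b"
      unfolding w_def using x by (simp_all add: J_restrict_in co_J_restrict)
    have "hnorm V (s m \<ominus>\<^bsub>V\<^esub> w) = sqrt (\<Sum>b\<in>B. (hnorm K (co (s m) b \<ominus> x b))\<^sup>2)" for m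
      using s w V.M.minus_closed by (simp add: hnorm_power co_minus)
    moreover have "(\<lambda>m. sqrt (\<Sum>b\<in>B. (hnorm K (co (s m) b \<ominus> x b))\<^sup>2)) \<longlonglongrightarrow> sqrt (\<Sum>b\<in>B. 0\<^sup>2)"
      by (intro tendsto_real_sqrt tendsto_sum tendsto_power lim)
    ultimately show "\<exists>w\<in>carrier V. (\<lambda>m. hnorm V (s m \<ominus>\<^bsub>V\<^esub> w)) \<longlonglongrightarrow> 0"
      using w(1) by (intro bexI[of _ w]) simp_all
  qed
qed

end

sublocale hilbert_power \<subseteq> V: hilbert_space "hpower J B K"
  by (rule hilbert_space_power)

text \<open>The operators used below: coordinate \<open>b\<close> of the image is \<open>c \<cdot> A\<close> applied to coordinate \<open>g b\<close> of the
  argument, and \<open>0\<close> if \<open>g b\<close> is undefined.  On the power of the complex numbers these are weighted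
  partial permutation matrices (for \<open>g\<close> injective).\<close>

definition coord_op :: "(('i \<Rightarrow> 'a) \<Rightarrow> 'b) \<Rightarrow> 'i set \<Rightarrow> 'a hspace \<Rightarrow>
    ('i \<Rightarrow> 'i option) \<Rightarrow> complex \<Rightarrow> ('a \<Rightarrow> 'a) \<Rightarrow> 'b \<Rightarrow> 'b" where
  "coord_op J B K g c A = (\<lambda>z\<in>carrier (hpower J B K). J (\<lambda>b\<in>B.
     case g b of None \<Rightarrow> \<zero>\<^bsub>K\<^esub> | Some d \<Rightarrow> c \<odot>\<^bsub>K\<^esub> A (coord J B K z d)))"

context hilbert_power begin

abbreviation "cop \<equiv> coord_op J B K"

text \<open>Outside of \<open>B\<close> the map is unconstrained, so that maps defined on all multiwords can be used for
  every truncation.\<close>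

definition pmap :: "('i \<Rightarrow> 'i option) \<Rightarrow> bool" where
  "pmap g \<longleftrightarrow> (\<forall>b\<in>B. \<forall>d. g b = Some d \<longrightarrow> d \<in> B)"

lemma cop_entry_in:
  assumes "A \<in> carrier (bop K)" "pmap g" "z \<in> carrier V" "b \<in> B"
  shows "(case g b of None \<Rightarrow> \<zero> | Some d \<Rightarrow> c \<odot> A (co z d)) \<in> carrier K"
  using assms by (auto simp: pmap_def co_in bop_closed split: option.split)

lemma
  assumes "A \<in> carrier (bop K)" "pmap g" "z \<in> carrier V"
  shows cop_in: "cop g c A z \<in> carrier V"
    and co_cop: "b \<in> B \<Longrightarrow> co (cop g c A z) b = (case g b of None \<Rightarrow> \<zero> | Some d \<Rightarrow> c \<odot> A (co z d))"
  using cop_entry_in[OF assms, of _ c] assms(3)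
  by (simp_all add: coord_op_def J_restrict_in co_J_restrict)

text \<open>This bounds the images of coordinate operators: an index map that takes a value several times can make
  the norm exceed that of the entries, but by the square root of the number of coordinates at most.\<close>

lemma hnorm_power_le:
  assumes z: "z \<in> carrier V" and N: "0 \<le> N" "\<And>b. b \<in> B \<Longrightarrow> hnorm K (co z b) \<le> N"
  shows "hnorm V z \<le> sqrt (card B) * N"
proof -
  have "(\<Sum>b\<in>B. (hnorm K (co z b))\<^sup>2) \<le> (\<Sum>b\<in>B. N\<^sup>2)"
    using N z by (intro sum_mono power_mono) (auto simp: hnorm_nonneg co_in)
  then have "hnorm V z \<le> sqrt (real (card B) * N\<^sup>2)"
    using z by (simp add: hnorm_power)
  then show ?thesis using N by (simp add: real_sqrt_mult)
qed

lemma hnorm_power_mono: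
  assumes z: "z \<in> carrier V" and w: "w \<in> carrier V" and N: "0 \<le> N"
    and le: "\<And>b. b \<in> B \<Longrightarrow> hnorm K (co z b) \<le> N * hnorm K (co w b)"
  shows "hnorm V z \<le> N * hnorm V w"
proof -
  have "(\<Sum>b\<in>B. (hnorm K (co z b))\<^sup>2) \<le> (\<Sum>b\<in>B. (N * hnorm K (co w b))\<^sup>2)"
    using z by (intro sum_mono power_mono le) (auto simp: hnorm_nonneg co_in)
  also have "\<dots> = N\<^sup>2 * (\<Sum>b\<in>B. (hnorm K (co w b))\<^sup>2)"
    by (simp add: power_mult_distrib sum_distrib_left)
  finally have "hnorm V z \<le> sqrt (N\<^sup>2 * (\<Sum>b\<in>B. (hnorm K (co w b))\<^sup>2))"
    using z by (simp add: hnorm_power)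
  then show ?thesis using N w by (simp add: real_sqrt_mult hnorm_power)
qed

lemma cop_bop:
  assumes A: "A \<in> carrier (bop K)" and g: "pmap g"
  shows "cop g c A \<in> carrier (bop V)"
proof -
  obtain M where M: "0 \<le> M" "\<And>x. x \<in> carrier K \<Longrightarrow> hnorm K (A x) \<le> M * hnorm K x"
    using bop_bounded[OF A] by blast
  note [simp] = cop_in[OF A g] co_cop[OF A g] co_in
  show ?thesis
  proof (rule V.bopI[where M = "sqrt (card B) * (cmod c * M)"])
    fix z w assume zw: "z \<in> carrier V" "w \<in> carrier V"
    show "cop g c A (z \<oplus>\<^bsub>V\<^esub> w) = cop g c A z \<oplus>\<^bsub>V\<^esub> cop g c A w"
    proof (rule co_ext)
      fix b assume b: "b \<in> B"
      show "co (cop g c A (z \<oplus>\<^bsub>V\<^esub> w)) b = co (cop g c A z \<oplus>\<^bsub>V\<^esub> cop g c A w) b"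
      proof (cases "g b")
        case (Some d)
        then have "d \<in> B" using g b unfolding pmap_def by blast
        then show ?thesis using zw b Some A
          by (simp add: co_add bop_add bop_closed smult_r_distr)
      qed (use zw b in \<open>simp add: co_add\<close>)
    qed (use zw in auto)
  next
    fix a z assume z: "z \<in> carrier V"
    show "cop g c A (a \<odot>\<^bsub>V\<^esub> z) = a \<odot>\<^bsub>V\<^esub> cop g c A z"
    proof (rule co_ext)
      fix b assume b: "b \<in> B"
      show "co (cop g c A (a \<odot>\<^bsub>V\<^esub> z)) b = co (a \<odot>\<^bsub>V\<^esub> cop g c A z) b"
      proof (cases "g b")
        case (Some d)
        then have "d \<in> B" using g b unfolding pmap_def by blast
        then have d: "A (co z d) \<in> carrier K" using z A by (simp add: bop_closed)
        from \<open>d \<in> B\<close> show ?thesis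
          using z b Some A smult_assoc1[OF _ _ d, of a c] smult_assoc1[OF _ _ d, of c a]
          by (simp add: co_smult bop_smult mult.commute)
      qed (use z b in \<open>simp add: co_smult\<close>)
    qed (use z in auto)
  next
    fix z assume z: "z \<in> carrier V"
    have "hnorm V (cop g c A z) \<le> sqrt (card B) * (cmod c * M * hnorm V z)"
    proof (rule hnorm_power_le)
      fix b assume b: "b \<in> B"
      show "hnorm K (co (cop g c A z) b) \<le> cmod c * M * hnorm V z"
      proof (cases "g b")
        case None
        then show ?thesis using z b M(1) by (simp add: hnorm_zero V.hnorm_nonneg)
      next
        case (Some d)
        then have d: "d \<in> B" using g b unfolding pmap_def by blast
        have "hnorm K (A (co z d)) \<le> M * hnorm K (co z d)" using M(2) z d by simp
        also have "\<dots> \<le> M * hnorm V z"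
          using hnorm_co_le[OF z d] M(1) by (rule mult_left_mono)
        finally show ?thesis
          using Some z b d A by (simp add: hnorm_smult bop_closed mult_left_mono mult.assoc)
      qed
    qed (use z M in \<open>auto simp: V.hnorm_nonneg\<close>)
    then show "hnorm V (cop g c A z) \<le> sqrt (card B) * (cmod c * M) * hnorm V z"
      by (simp add: mult.assoc)
  next
    show "cop g c A \<in> extensional (carrier V)" by (simp add: coord_op_def)
  qed (simp_all add: cop_in[OF A g])
qed

text \<open>The image reads its coordinates from the argument, so the index maps compose in the
  opposite order of the operators.\<close>

lemma cop_mult:
  assumes A: "A \<in> carrier (bop K)" "A' \<in> carrier (bop K)" and g: "pmap g" "pmap h"
  shows "cop g c A \<otimes>\<^bsub>bop V\<^esub> cop h d A' = cop (h \<circ>\<^sub>m g) (c * d) (A \<otimes>\<^bsub>bop K\<^esub> A')"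
proof -
  have hg: "pmap (h \<circ>\<^sub>m g)"
    using g unfolding pmap_def map_comp_def by (fastforce split: option.splits)
  have AA: "A \<otimes>\<^bsub>bop K\<^esub> A' \<in> carrier (bop K)" using A by (rule mult_in_bop)
  show ?thesis
  proof (rule V.bop_ext)
    fix z assume z: "z \<in> carrier V"
    define w where "w = cop h d A' z"
    have w: "w \<in> carrier V" unfolding w_def using A(2) g(2) z by (rule cop_in)
    have "cop g c A w = cop (h \<circ>\<^sub>m g) (c * d) (A \<otimes>\<^bsub>bop K\<^esub> A') z"
    proof (rule co_ext)
      fix b assume b: "b \<in> B"
      note co = co_cop[OF A(1) g(1) w b, of c] co_cop[OF AA hg z b, of "c * d"]
      show "co (cop g c A w) b = co (cop (h \<circ>\<^sub>m g) (c * d) (A \<otimes>\<^bsub>bop K\<^esub> A') z) b"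
      proof (cases "g b")
        case None
        then show ?thesis by (simp only: co map_comp_simps option.case)
      next
        case (Some b')
        then have b': "b' \<in> B" using g b unfolding pmap_def by blast
        have w_co: "co w b' = (case h b' of None \<Rightarrow> \<zero> | Some e \<Rightarrow> d \<odot> A' (co z e))"
          unfolding w_def by (rule co_cop[OF A(2) g(2) z b'])
        show ?thesis
        proof (cases "h b'")
          case None
          then show ?thesis
            using \<open>g b = Some b'\<close>
            by (simp only: co w_co map_comp_simps option.case bop_zero_image[OF A(1)] smult_r_null
              ring_of_type_algebra_simps(1) UNIV_I)
        next
          case (Some e)
          then have "e \<in> B" using g b' unfolding pmap_def by blast
          then have x: "co z e \<in> carrier K" using z by (simp add: co_in)
          note y = bop_closed[OF A(2) x]
          show ?thesis
            using Some \<open>g b = Some b'\<close> smult_assoc1[OF _ _ bop_closed[OF A(1) y], of c d]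
            by (simp only: co w_co map_comp_simps option.case bop_smult[OF A(1) y]
              bop_apply_simps(4)[OF x] ring_of_type_algebra_simps UNIV_I)
        qed
      qed
    qed (use cop_in[OF A(1) g(1) w] cop_in[OF AA hg z] in auto)
    then show "(cop g c A \<otimes>\<^bsub>bop V\<^esub> cop h d A') z = cop (h \<circ>\<^sub>m g) (c * d) (A \<otimes>\<^bsub>bop K\<^esub> A') z"
      unfolding V.bop_apply_simps(4)[OF z] w_def .
  qed (use A g hg AA in \<open>auto intro: V.mult_in_bop cop_bop\<close>)
qed

lemma cop_one: "cop Some 1 \<one>\<^bsub>bop K\<^esub> = \<one>\<^bsub>bop V\<^esub>"
proof (rule V.bop_ext)
  have S: "pmap Some" by (simp add: pmap_def)
  then show "cop Some 1 \<one>\<^bsub>bop K\<^esub> \<in> carrier (bop V)" by (intro cop_bop one_in_bop)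
  fix z assume z: "z \<in> carrier V"
  show "cop Some 1 \<one>\<^bsub>bop K\<^esub> z = \<one>\<^bsub>bop V\<^esub> z"
  proof (rule co_ext)
    fix b assume b: "b \<in> B"
    show "co (cop Some 1 \<one>\<^bsub>bop K\<^esub> z) b = co (\<one>\<^bsub>bop V\<^esub> z) b"
      using co_cop[OF one_in_bop S z b, of 1] co_in[OF z b] smult_one[of "co z b"]
      by (simp add: V.bop_apply_simps(2)[OF z] bop_apply_simps(2))
  qed (use z cop_in[OF one_in_bop S z] in \<open>simp_all add: V.bop_apply_simps(2)\<close>)
qed (rule V.one_in_bop)

lemma cop_cong:
  assumes "\<And>b. b \<in> B \<Longrightarrow> g b = h b"
  shows "cop g c A = cop h c A"
  using assms by (simp add: coord_op_def cong: restrict_cong)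

lemma hinner_cop:
  assumes g: "pmap g" and z: "z \<in> carrier V" and w: "w \<in> carrier V"
  shows "hinner V (cop g c \<one>\<^bsub>bop K\<^esub> z) w =
    (\<Sum>b\<in>B. \<Sum>d\<in>B. if g b = Some d then c * hinner K (co z d) (co w b) else 0)"
  unfolding hinner_power
proof (rule sum.cong)
  fix b assume b: "b \<in> B"
  note [simp] = co_cop[OF one_in_bop g z b]
  show "hinner K (co (cop g c \<one>\<^bsub>bop K\<^esub> z) b) (co w b) =
    (\<Sum>d\<in>B. if g b = Some d then c * hinner K (co z d) (co w b) else 0)"
  proof (cases "g b")
    case None
    then show ?thesis using b w by (simp add: hinner_zero_left co_in)
  next
    case (Some d)
    then have "d \<in> B" using g b unfolding pmap_def by blast
    then show ?thesis
      using Some b w z finite_B by (simp add: hinner_smult co_in bop_apply_simps)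
  qed
qed simp

text \<open>Transposition of a partial permutation matrix inverts the permutation.  Both inner products are
  written as sums over all pairs of indices, which differ by the order of summation only.\<close>

lemma adj_cop:
  assumes g: "pmap g" and h: "pmap h"
    and inv: "\<And>b d. b \<in> B \<Longrightarrow> d \<in> B \<Longrightarrow> g b = Some d \<longleftrightarrow> h d = Some b"
  shows "adj V (cop g c \<one>\<^bsub>bop K\<^esub>) = cop h (cnj c) \<one>\<^bsub>bop K\<^esub>"
proof (rule V.adj_eqI)
  fix z w assume z: "z \<in> carrier V" and w: "w \<in> carrier V"
  have "hinner V z (cop h (cnj c) \<one>\<^bsub>bop K\<^esub> w) = cnj (hinner V (cop h (cnj c) \<one>\<^bsub>bop K\<^esub> w) z)"
    using z w h by (intro V.hinner_commute cop_in one_in_bop)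
  also have "\<dots> = (\<Sum>d\<in>B. \<Sum>b\<in>B. if h d = Some b then c * cnj (hinner K (co w b) (co z d)) else 0)"
    unfolding hinner_cop[OF h w z] by (simp add: if_distrib cong: if_cong)
  also have "\<dots> = (\<Sum>d\<in>B. \<Sum>b\<in>B. if g b = Some d then c * hinner K (co z d) (co w b) else 0)"
    using inv z w by (intro sum.cong refl) (auto simp: hinner_commute[symmetric] co_in)
  also have "\<dots> = (\<Sum>b\<in>B. \<Sum>d\<in>B. if g b = Some d then c * hinner K (co z d) (co w b) else 0)"
    by (rule sum.swap)
  also have "\<dots> = hinner V (cop g c \<one>\<^bsub>bop K\<^esub> z) w"
    by (rule hinner_cop[OF g z w, symmetric])
  finally show "hinner V (cop g c \<one>\<^bsub>bop K\<^esub> z) w = hinner V z (cop h (cnj c) \<one>\<^bsub>bop K\<^esub> w)" ..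
qed (use g h in \<open>auto intro: cop_bop one_in_bop\<close>)

end

section \<open>Tensor products with finite-dimensional spaces\<close>

definition complex_hspace :: "complex hspace" where
  "complex_hspace = \<lparr>carrier = UNIV, monoid.mult = (*), one = 1, ring.zero = 0, add = (+),
     module.smult = (*), hinner = (\<lambda>x y. x * cnj y)\<rparr>"

lemma complex_hspace_simps [simp]:
  "carrier complex_hspace = UNIV"
  "\<zero>\<^bsub>complex_hspace\<^esub> = 0"
  "x \<oplus>\<^bsub>complex_hspace\<^esub> y = x + y"
  "x \<odot>\<^bsub>complex_hspace\<^esub> y = x * y"
  "hinner complex_hspace x y = x * cnj y"
  by (simp_all add: complex_hspace_def)

lemma hnorm_complex [simp]: "hnorm complex_hspace x = cmod x"
  by (simp add: hnorm_def complex_norm_square[symmetric] flip: cmod_power2)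

lemma abelian_group_complex: "abelian_group complex_hspace"
proof (rule abelian_groupI)
  fix x :: complex
  show "\<exists>y\<in>carrier complex_hspace. y \<oplus>\<^bsub>complex_hspace\<^esub> x = \<zero>\<^bsub>complex_hspace\<^esub>"
    by (rule bexI[of _ "- x"]) auto
qed auto

lemma minus_complex [simp]: "x \<ominus>\<^bsub>complex_hspace\<^esub> y = x - y"
proof -
  interpret abelian_group complex_hspace by (rule abelian_group_complex)
  have "\<ominus>\<^bsub>complex_hspace\<^esub> y = - y" by (rule minus_equality) auto
  then show ?thesis by (simp add: a_minus_def)
qed

lemma finsum_complex: "finsum complex_hspace f S = sum f S"
proof -
  interpret abelian_group complex_hspace by (rule abelian_group_complex)
  show ?thesis
    by (induction S rule: infinite_finite_induct) auto
qed

lemma hilbert_space_complex: "hilbert_space complex_hspace"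
proof -
  interpret module "ring_of_type_algebra :: complex ring" complex_hspace
  proof (rule moduleI)
    show "cring (ring_of_type_algebra :: complex ring)" by (rule cring_from_type_algebra)
  qed (auto simp: abelian_group_complex algebra_simps)
  show ?thesis
  proof unfold_locales
    fix x :: complex
    assume "x \<noteq> \<zero>\<^bsub>complex_hspace\<^esub>"
    then show "0 < Re (hinner complex_hspace x x)"
      by (simp add: complex_norm_square[symmetric] del: of_real_power)
  next
    fix s :: "nat \<Rightarrow> complex"
    assume "\<forall>e>0. \<exists>N. \<forall>m\<ge>N. \<forall>l\<ge>N. hnorm complex_hspace (s m \<ominus>\<^bsub>complex_hspace\<^esub> s l) < e"
    then have "Cauchy s" by (simp add: Cauchy_def dist_norm)
    then obtain x where "s \<longlonglongrightarrow> x" using Cauchy_convergent convergentD by blast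
    then have "(\<lambda>m. cmod (s m - x)) \<longlonglongrightarrow> 0" by (simp add: LIM_zero_iff tendsto_norm_zero)
    then show "\<exists>x\<in>carrier complex_hspace.
        (\<lambda>m. hnorm complex_hspace (s m \<ominus>\<^bsub>complex_hspace\<^esub> x)) \<longlonglongrightarrow> 0"
      by auto
  qed (auto simp: algebra_simps)
qed

text \<open>The difference of the two operators is bounded and vanishes on finite sums of elementary tensors,
  which are dense.\<close>

lemma hilbert_tensor_ext:
  assumes L: "hilbert_tensor K H L \<tau>"
    and S: "S \<in> carrier (bop L)" and T: "T \<in> carrier (bop L)"
    and eq: "\<And>x y. x \<in> carrier K \<Longrightarrow> y \<in> carrier H \<Longrightarrow> S (\<tau> x y) = T (\<tau> x y)"
  shows "S = T"
proof -
  interpret L: hilbert_space L using L by (simp add: hilbert_tensor_def)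
  interpret B: abelian_group "bop L" by (rule L.abelian_group_bop)
  define D where "D = S \<ominus>\<^bsub>bop L\<^esub> T"
  have D: "D \<in> carrier (bop L)" using S T by (simp add: D_def)
  have \<tau>: "\<tau> x y \<in> carrier L" if "x \<in> carrier K" "y \<in> carrier H" for x y
    using L that by (simp add: hilbert_tensor_def)
  have D_\<tau>: "D (\<tau> x y) = \<zero>\<^bsub>L\<^esub>" if "x \<in> carrier K" "y \<in> carrier H" for x y
    unfolding D_def
    using eq[OF that] L.minus_apply[OF \<tau>[OF that] S T] L.bop_closed[OF T \<tau>[OF that]]
    by (simp add: L.right_minus_eq_iff)
  obtain M where M: "0 \<le> M" "\<And>z. z \<in> carrier L \<Longrightarrow> hnorm L (D z) \<le> M * hnorm L z"
    using L.bop_bounded[OF D] by blast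
  have D_add: "(\<lambda>z. D z) \<in> carrier L \<rightarrow> carrier L"
    "\<And>z w. z \<in> carrier L \<Longrightarrow> w \<in> carrier L \<Longrightarrow> D (z \<oplus>\<^bsub>L\<^esub> w) = D z \<oplus>\<^bsub>L\<^esub> D w"
    using D by (auto simp: L.bop_closed L.bop_add)
  have "hnorm L (D z) = 0" if z: "z \<in> carrier L" for z
  proof (rule antisym)
    have "hnorm L (D z) \<le> M * e" if e: "e > 0" for e
    proof -
      obtain m :: nat and u v where uv: "\<forall>i<m. u i \<in> carrier K \<and> v i \<in> carrier H"
        and close: "hnorm L (z \<ominus>\<^bsub>L\<^esub> (\<Oplus>\<^bsub>L\<^esub>i\<in>{..<m}. \<tau> (u i) (v i))) < e"
        using L z e unfolding hilbert_tensor_def by meson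
      define w where "w = (\<Oplus>\<^bsub>L\<^esub>i\<in>{..<m}. \<tau> (u i) (v i))"
      have w: "w \<in> carrier L"
        unfolding w_def using uv \<tau> by (intro L.M.finsum_closed) auto
      have "D w = (\<Oplus>\<^bsub>L\<^esub>i\<in>{..<m}. D (\<tau> (u i) (v i)))"
        unfolding w_def
        by (rule additive_finsum[OF L.M.abelian_group_axioms L.M.abelian_group_axioms])
          (use uv \<tau> D_add in auto)
      also have "\<dots> = (\<Oplus>\<^bsub>L\<^esub>i\<in>{..<m}. \<zero>\<^bsub>L\<^esub>)"
        by (rule finsum_cong_plain) (use uv D_\<tau> in auto)
      also have "\<dots> = \<zero>\<^bsub>L\<^esub>" by (rule L.M.finsum_zero)
      finally have "D (z \<ominus>\<^bsub>L\<^esub> w) = D z \<ominus>\<^bsub>L\<^esub> \<zero>\<^bsub>L\<^esub>"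
        using additive_minus[where h = D, OF L.M.abelian_group_axioms L.M.abelian_group_axioms D_add z w]
        by simp
      then have "D (z \<ominus>\<^bsub>L\<^esub> w) = D z"
        using L.bop_closed[OF D z] by (simp add: a_minus_def)
      then have "hnorm L (D z) \<le> M * hnorm L (z \<ominus>\<^bsub>L\<^esub> w)"
        using M(2)[of "z \<ominus>\<^bsub>L\<^esub> w"] z w by simp
      also have "\<dots> \<le> M * e"
        using close M(1) by (intro mult_left_mono) (auto simp: w_def)
      finally show ?thesis .
    qed
    then have "hnorm L (D z) \<le> e" if "e > 0" for e
      using that M(1) by (cases "M = 0") (force dest: spec[of _ "e / M"], metis divide_pos_pos
        less_le nonzero_mult_div_cancel_left times_divide_eq_right)
    then show "hnorm L (D z) \<le> 0" by (rule field_le_epsilon[of _ 0, simplified])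
  qed (use L.bop_closed[OF D z] in \<open>simp add: L.hnorm_nonneg\<close>)
  then have "D z = \<zero>\<^bsub>L\<^esub>" if "z \<in> carrier L" for z
    using that L.hnorm_eq_0_iff L.bop_closed[OF D] by blast
  then have "S z = T z" if z: "z \<in> carrier L" for z
    using z L.minus_apply[OF z S T]
      L.right_minus_eq_iff[OF L.bop_closed[OF S z] L.bop_closed[OF T z]]
    unfolding D_def by metis
  then show ?thesis by (rule L.bop_ext[OF S T])
qed

lemma op_tensor_eqI:
  assumes "hilbert_tensor K H L \<tau>" "S \<in> carrier (bop L)"
    and "\<And>x y. x \<in> carrier K \<Longrightarrow> y \<in> carrier H \<Longrightarrow> S (\<tau> x y) = \<tau> (A x) (T y)"
  shows "op_tensor K H L \<tau> A T = S"
  unfolding op_tensor_def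
  by (rule the_equality) (use assms hilbert_tensor_ext[OF assms(1)] in auto)

text \<open>With coordinates over the same index set \<open>B\<close>, the elementary tensor of \<open>x\<close> and \<open>y\<close> is the family
  of the vectors \<open>y\<^sub>b \<cdot> x\<close>.\<close>

locale power_tensor = L: hilbert_power K J' B + H: hilbert_power complex_hspace J B
  for K :: "'a hspace" (structure) and J' :: "('i \<Rightarrow> 'a) \<Rightarrow> 'l" and B :: "'i set"
    and J :: "('i \<Rightarrow> complex) \<Rightarrow> 'h"
begin

definition \<tau> :: "'a \<Rightarrow> 'h \<Rightarrow> 'l" where
  "\<tau> x y = J' (\<lambda>b\<in>B. H.co y b \<odot> x)"

definition basis :: "'i \<Rightarrow> 'h" where
  "basis b = J (\<lambda>d\<in>B. if d = b then 1 else 0)"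

lemma basis_in: "basis b \<in> carrier H.V"
  unfolding basis_def by (rule H.J_restrict_in) simp

lemma co_basis: "d \<in> B \<Longrightarrow> H.co (basis b) d = (if d = b then 1 else 0)"
  unfolding basis_def by (rule H.co_J_restrict) simp_all

lemma \<tau>_in: "x \<in> carrier K \<Longrightarrow> \<tau> x y \<in> carrier L.V"
  unfolding \<tau>_def by (rule L.J_restrict_in) simp

lemma co_\<tau>: "x \<in> carrier K \<Longrightarrow> b \<in> B \<Longrightarrow> L.co (\<tau> x y) b = H.co y b \<odot> x"
  unfolding \<tau>_def by (rule L.co_J_restrict) simp_all

lemma sum_\<tau>_basis:
  assumes z: "z \<in> carrier L.V" and h: "bij_betw h {..<m} B"
  shows "z = (\<Oplus>\<^bsub>L.V\<^esub>i\<in>{..<m::nat}. \<tau> (L.co z (h i)) (basis (h i)))"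
proof -
  have hB: "h i \<in> B" if "i < m" for i using h that by (auto simp: bij_betw_def)
  have \<tau>z: "\<tau> (L.co z (h i)) (basis (h i)) \<in> carrier L.V" if "i < m" for i
    using \<tau>_in L.co_in[OF z hB[OF that]] by blast
  show ?thesis
  proof (rule L.co_ext[OF z])
    show "(\<Oplus>\<^bsub>L.V\<^esub>i\<in>{..<m}. \<tau> (L.co z (h i)) (basis (h i))) \<in> carrier L.V"
      using \<tau>z by (intro L.V.M.finsum_closed) auto
    fix b assume b: "b \<in> B"
    then obtain j where j: "j < m" "h j = b" using h by (auto simp: bij_betw_def)
    have "L.co (\<Oplus>\<^bsub>L.V\<^esub>i\<in>{..<m}. \<tau> (L.co z (h i)) (basis (h i))) b
        = (\<Oplus>i\<in>{..<m}. L.co (\<tau> (L.co z (h i)) (basis (h i))) b)"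
      by (rule L.co_finsum) (use \<tau>z b in auto)
    also have "\<dots> = (\<Oplus>i\<in>{..<m}. if j = i then L.co z (h i) else \<zero>)"
    proof (rule finsum_cong_plain)
      fix i assume i: "i \<in> {..<m}"
      then have x: "L.co z (h i) \<in> carrier K" using L.co_in[OF z hB] by simp
      have "b = h i \<longleftrightarrow> j = i"
        using i j h by (auto simp: bij_betw_def inj_on_def)
      then show "L.co (\<tau> (L.co z (h i)) (basis (h i))) b = (if j = i then L.co z (h i) else \<zero>)"
        using L.smult_one[OF x] L.smult_l_null[OF x] by (simp add: co_\<tau>[OF x b] co_basis[OF b])
    qed
    also have "\<dots> = L.co z (h j)"
      by (rule L.M.finsum_singleton) (use j L.co_in[OF z hB] in auto)
    finally show "L.co z b = L.co (\<Oplus>\<^bsub>L.V\<^esub>i\<in>{..<m}. \<tau> (L.co z (h i)) (basis (h i))) b"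
      using j by simp
  qed
qed

lemma hilbert_tensor_power: "hilbert_tensor K H.V L.V \<tau>"
  unfolding hilbert_tensor_def
proof (intro conjI ballI allI impI)
  fix x x' y y' assume x: "x \<in> carrier K" and x': "x' \<in> carrier K"
    and y: "y \<in> carrier H.V" and y': "y' \<in> carrier H.V"
  have "hinner L.V (\<tau> x y) (\<tau> x' y') = (\<Sum>b\<in>B. hinner K x x' * (H.co y b * cnj (H.co y' b)))"
    unfolding L.hinner_power
    by (rule sum.cong)
      (use x x' in \<open>simp_all add: co_\<tau> L.hinner_smult L.hinner_smult_right\<close>)
  then show "hinner L.V (\<tau> x y) (\<tau> x' y') = hinner K x x' * hinner H.V y y'"
    by (simp add: H.hinner_power sum_distrib_left)
next
  fix x x' y assume x: "x \<in> carrier K" "x' \<in> carrier K"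
  show "\<tau> (x \<oplus> x') y = \<tau> x y \<oplus>\<^bsub>L.V\<^esub> \<tau> x' y"
    by (rule L.co_ext)
      (use x in \<open>simp_all add: \<tau>_in co_\<tau> L.co_add L.power_closed L.smult_r_distr\<close>)
next
  fix x y y' assume x: "x \<in> carrier K" and y: "y \<in> carrier H.V" "y' \<in> carrier H.V"
  show "\<tau> x (y \<oplus>\<^bsub>H.V\<^esub> y') = \<tau> x y \<oplus>\<^bsub>L.V\<^esub> \<tau> x y'"
  proof (rule L.co_ext)
    fix b assume b: "b \<in> B"
    then show "L.co (\<tau> x (y \<oplus>\<^bsub>H.V\<^esub> y')) b = L.co (\<tau> x y \<oplus>\<^bsub>L.V\<^esub> \<tau> x y') b"
      using L.smult_l_distr[OF _ _ x] x y by (simp add: \<tau>_in co_\<tau> L.co_add H.co_add)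
  qed (use x in \<open>simp_all add: \<tau>_in L.power_closed\<close>)
next
  fix c x y assume x: "x \<in> carrier K" and y: "y \<in> carrier H.V"
  show "\<tau> (c \<odot> x) y = c \<odot>\<^bsub>L.V\<^esub> \<tau> x y"
  proof (rule L.co_ext)
    fix b assume b: "b \<in> B"
    show "L.co (\<tau> (c \<odot> x) y) b = L.co (c \<odot>\<^bsub>L.V\<^esub> \<tau> x y) b"
      using L.smult_assoc1[OF _ _ x, of c "H.co y b"] L.smult_assoc1[OF _ _ x, of "H.co y b" c] x b
      by (simp add: \<tau>_in co_\<tau> L.co_smult mult.commute)
  qed (use x in \<open>simp_all add: \<tau>_in L.power_closed\<close>)
  show "\<tau> x (c \<odot>\<^bsub>H.V\<^esub> y) = c \<odot>\<^bsub>L.V\<^esub> \<tau> x y"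
  proof (rule L.co_ext)
    fix b assume b: "b \<in> B"
    show "L.co (\<tau> x (c \<odot>\<^bsub>H.V\<^esub> y)) b = L.co (c \<odot>\<^bsub>L.V\<^esub> \<tau> x y) b"
      using L.smult_assoc1[OF _ _ x, of c "H.co y b"] x y b
      by (simp add: \<tau>_in co_\<tau> L.co_smult H.co_smult)
  qed (use x in \<open>simp_all add: \<tau>_in L.power_closed\<close>)
next
  fix z and e :: real assume z: "z \<in> carrier L.V" and e: "e > 0"
  obtain h where h: "bij_betw h {..<card B} B"
    using ex_bij_betw_nat_finite[OF L.finite_B] by (auto simp: atLeast0LessThan)
  let ?u = "\<lambda>i. L.co z (h i)" and ?v = "\<lambda>i. basis (h i)"
  have "hnorm L.V (z \<ominus>\<^bsub>L.V\<^esub> z) < e"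
    using e z L.V.right_minus_eq_iff[OF z z] by (simp add: L.V.hnorm_zero)
  then have close: "hnorm L.V (z \<ominus>\<^bsub>L.V\<^esub> (\<Oplus>\<^bsub>L.V\<^esub>i\<in>{..<card B}. \<tau> (?u i) (?v i))) < e"
    using sum_\<tau>_basis[OF z h] by simp
  have uv: "\<forall>i<card B. ?u i \<in> carrier K \<and> ?v i \<in> carrier H.V"
    using L.co_in[OF z] basis_in h by (auto simp: bij_betw_def)
  show "\<exists>(m::nat) u v. (\<forall>i<m. u i \<in> carrier K \<and> v i \<in> carrier H.V) \<and>
      hnorm L.V (z \<ominus>\<^bsub>L.V\<^esub> (\<Oplus>\<^bsub>L.V\<^esub>i\<in>{..<m}. \<tau> (u i) (v i))) < e"
    by (rule exI[of _ "card B"], rule exI[of _ ?u], rule exI[of _ ?v], rule conjI[OF uv close])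
qed (use \<tau>_in L.hilbert_space_axioms L.V.hilbert_space_axioms H.V.hilbert_space_axioms in auto)

lemma cop_\<tau>:
  assumes A: "A \<in> carrier (bop K)" and g: "L.pmap g"
    and x: "x \<in> carrier K" and y: "y \<in> carrier H.V"
  shows "L.cop g c A (\<tau> x y) = \<tau> (A x) (H.cop g c \<one>\<^bsub>bop complex_hspace\<^esub> y)"
proof (rule L.co_ext)
  have Ax: "A x \<in> carrier K" using A x by (rule L.bop_closed)
  then show "\<tau> (A x) (H.cop g c \<one>\<^bsub>bop complex_hspace\<^esub> y) \<in> carrier L.V" by (rule \<tau>_in)
  show "L.cop g c A (\<tau> x y) \<in> carrier L.V" using A g \<tau>_in[OF x] by (rule L.cop_in)
  fix b assume b: "b \<in> B"
  show "L.co (L.cop g c A (\<tau> x y)) b = L.co (\<tau> (A x) (H.cop g c \<one>\<^bsub>bop complex_hspace\<^esub> y)) b"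
  proof (cases "g b")
    case None
    then show ?thesis
      unfolding L.co_cop[OF A g \<tau>_in[OF x] b] co_\<tau>[OF Ax b] H.co_cop[OF H.one_in_bop g y b]
      using L.smult_l_null[OF Ax] by simp
  next
    case (Some d)
    then have d: "d \<in> B" using g b unfolding L.pmap_def by blast
    show ?thesis
      unfolding L.co_cop[OF A g \<tau>_in[OF x] b] co_\<tau>[OF Ax b] H.co_cop[OF H.one_in_bop g y b]
      using Some L.smult_assoc1[OF _ _ Ax, of c "H.co y d"]
      by (simp add: co_\<tau>[OF x d] L.bop_smult[OF A x] H.bop_apply_simps)
  qed
qed

lemma op_tensor_cop:
  assumes A: "A \<in> carrier (bop K)" and g: "L.pmap g"
  shows "op_tensor K H.V L.V \<tau> A (H.cop g c \<one>\<^bsub>bop complex_hspace\<^esub>) = L.cop g c A"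
  by (rule op_tensor_eqI[OF hilbert_tensor_power]) (use A g L.cop_bop cop_\<tau> in auto)

end

section \<open>Multiwords\<close>

abbreviation total_length :: "nat list list \<Rightarrow> nat" where
  "total_length \<alpha> \<equiv> sum_list (map length \<alpha>)"

abbreviation mw_append :: "nat list list \<Rightarrow> nat list list \<Rightarrow> nat list list" where
  "mw_append \<equiv> map2 (@)"

text \<open>Left division of multiwords: \<open>strip \<alpha> \<gamma>\<close> is the \<open>\<delta>\<close> with \<open>\<gamma> = \<alpha> \<delta>\<close>, if there is one.\<close>

fun strip :: "nat list list \<Rightarrow> nat list list \<Rightarrow> nat list list option" where
  "strip [] [] = Some []"
| "strip (a # \<alpha>) (c # \<gamma>) =
     (if prefix a c then map_option ((#) (drop (length a) c)) (strip \<alpha> \<gamma>) else None)"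
| "strip _ _ = None"

lemma strip_eq_Some_iff:
  "strip \<alpha> \<gamma> = Some \<delta> \<longleftrightarrow> length \<delta> = length \<alpha> \<and> \<gamma> = mw_append \<alpha> \<delta>"
proof (induction \<alpha> \<gamma> arbitrary: \<delta> rule: strip.induct)
  case (2 a \<alpha> c \<gamma>)
  show ?case
  proof (cases \<delta>)
    case (Cons d \<delta>')
    have "prefix a c \<and> drop (length a) c = d \<longleftrightarrow> c = a @ d"
      by (auto simp: prefix_def)
    then show ?thesis using 2 Cons by auto
  qed auto
next
  case ("3_2" c \<gamma>)
  then show ?case by auto
qed (auto simp: Suc_length_conv)

lemma mw_append_assoc: "mw_append (mw_append \<alpha> \<beta>) \<gamma> = mw_append \<alpha> (mw_append \<beta> \<gamma>)"
proof (induction \<alpha> arbitrary: \<beta> \<gamma>)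
  case (Cons a \<alpha>)
  then show ?case by (cases \<beta>; cases \<gamma>) auto
qed simp

lemma total_length_mw_append:
  "length \<alpha> = length \<beta> \<Longrightarrow> total_length (mw_append \<alpha> \<beta>) = total_length \<alpha> + total_length \<beta>"
  by (induction \<alpha> \<beta> rule: list_induct2) auto

lemma mw_append_empty: "length \<alpha> = k \<Longrightarrow> mw_append \<alpha> (replicate k []) = \<alpha>"
  by (auto intro!: nth_equalityI)

lemma strip_mw_append:
  assumes "length \<alpha> = length \<beta>"
  shows "(strip \<beta> \<circ>\<^sub>m strip \<alpha>) \<gamma> = strip (mw_append \<alpha> \<beta>) \<gamma>"
proof -
  have "(strip \<beta> \<circ>\<^sub>m strip \<alpha>) \<gamma> = Some \<delta> \<longleftrightarrow> strip (mw_append \<alpha> \<beta>) \<gamma> = Some \<delta>" for \<delta>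
    using assms by (auto simp: map_comp_Some_iff strip_eq_Some_iff mw_append_assoc)
  then show ?thesis by (metis option.exhaust)
qed

lemma strip_empty: "length \<gamma> = k \<Longrightarrow> strip (replicate k []) \<gamma> = Some \<gamma>"
  by (auto simp: strip_eq_Some_iff intro!: nth_equalityI)

text \<open>The inclusion of the words of component \<open>i\<close> into the product monoid of multiwords with \<open>k\<close> components.\<close>

definition single :: "nat \<Rightarrow> nat \<Rightarrow> nat list \<Rightarrow> nat list list" where
  "single k i w = (replicate k [])[i := w]"

lemma length_single [simp]: "length (single k i w) = k"
  by (simp add: single_def)

lemma nth_single: "m < k \<Longrightarrow> single k i w ! m = (if m = i then w else [])"
  by (auto simp: single_def nth_list_update)

lemma single_append: "mw_append (single k i v) (single k i w) = single k i (v @ w)"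
  by (rule nth_equalityI) (auto simp: nth_single)

lemma single_commute:
  "s \<noteq> t \<Longrightarrow> mw_append (single k s v) (single k t w) = mw_append (single k t w) (single k s v)"
  by (rule nth_equalityI) (auto simp: nth_single)

lemma single_empty: "single k i [] = replicate k []"
  by (rule nth_equalityI) (auto simp: nth_single)

definition fock_index :: "nat list \<Rightarrow> nat \<Rightarrow> nat list list set" where
  "fock_index n N = {\<alpha> \<in> multiwords n. total_length \<alpha> \<le> N}"

lemma finite_fock_index: "finite (fock_index n N)"
proof (rule finite_subset)
  let ?W = "{w. set w \<subseteq> {..<sum_list n} \<and> length w \<le> N}"
  show "finite {\<alpha>. set \<alpha> \<subseteq> ?W \<and> length \<alpha> = length n}"
    by (intro finite_lists_length_eq finite_lists_length_le) auto
  show "fock_index n N \<subseteq> {\<alpha>. set \<alpha> \<subseteq> ?W \<and> length \<alpha> = length n}"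
  proof (clarsimp simp: fock_index_def multiwords_def)
    fix \<alpha> :: "nat list list" and w
    assume \<alpha>: "length \<alpha> = length n" "\<forall>i<length n. set (\<alpha> ! i) \<subseteq> {..<n ! i}" "total_length \<alpha> \<le> N"
      and w: "w \<in> set \<alpha>"
    obtain i where i: "i < length n" "w = \<alpha> ! i" using w \<alpha>(1) by (metis in_set_conv_nth)
    have "n ! i \<le> sum_list n" using i(1) by (intro member_le_sum_list) auto
    moreover have "length w \<le> total_length \<alpha>" using w by (intro member_le_sum_list) auto
    ultimately show "set w \<subseteq> {..<sum_list n} \<and> length w \<le> N"
      using \<alpha> i by fastforce
  qed
qed

lemma multiwords_of_length_subset: "multiwords_of_length n p \<subseteq> fock_index n (sum_list p)"
  by (auto simp: multiwords_of_length_def fock_index_def)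

lemma finite_multiwords_of_length: "finite (multiwords_of_length n p)"
  using multiwords_of_length_subset finite_fock_index by (rule finite_subset)

text \<open>Deleting a prefix neither introduces letters nor increases the length, so division maps the index
  set of the truncated Fock space to itself.\<close>

lemma strip_fock_index:
  assumes "\<gamma> \<in> fock_index n N" "strip \<alpha> \<gamma> = Some \<delta>"
  shows "\<delta> \<in> fock_index n N"
proof -
  have len: "length \<delta> = length \<alpha>" and \<gamma>: "\<gamma> = mw_append \<alpha> \<delta>"
    using assms(2) by (auto simp: strip_eq_Some_iff)
  then have "total_length \<delta> \<le> total_length \<gamma>" by (simp add: total_length_mw_append del: map_map)
  then show ?thesis
    using assms(1) len by (force simp: \<gamma> fock_index_def multiwords_def)
qed

section \<open>Truncated creation operators\<close>

locale truncated_fock = power_tensor K J' "fock_index n N" J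
  for K :: "'k hspace" (structure) and J' :: "(nat list list \<Rightarrow> 'k) \<Rightarrow> 'l"
    and n :: "nat list" and N :: nat and J :: "(nat list list \<Rightarrow> complex) \<Rightarrow> 'h"
begin

abbreviation "k \<equiv> length n"

text \<open>Coordinate \<open>\<gamma>\<close> of the image of \<open>y\<close> is coordinate \<open>\<delta>\<close> of \<open>y\<close> if \<open>\<gamma> = \<alpha> \<delta>\<close>, up to the scalar.  Hence the operator maps
  \<open>e\<^sub>\<delta>\<close> to \<open>r ^ |\<alpha>| \<cdot> e\<^sub>\<alpha>\<^sub>\<delta>\<close>, or to \<open>0\<close> if \<open>\<alpha> \<delta>\<close> exceeds the truncation.\<close>

definition creation :: "real \<Rightarrow> nat list list \<Rightarrow> 'h \<Rightarrow> 'h" where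
  "creation r \<alpha> = H.cop (strip \<alpha>) (complex_of_real r ^ total_length \<alpha>) \<one>\<^bsub>bop complex_hspace\<^esub>"

definition creation_tuple :: "real \<Rightarrow> ('h \<Rightarrow> 'h) list list" where
  "creation_tuple r = map (\<lambda>i. map (\<lambda>j. creation r (single k i [j])) [0..<n ! i]) [0..<k]"

lemma fock_index_length: "\<gamma> \<in> fock_index n N \<Longrightarrow> length \<gamma> = k"
  by (simp add: fock_index_def multiwords_def)

lemma pmap_strip: "L.pmap (strip \<alpha>)"
  using strip_fock_index unfolding L.pmap_def by blast

lemma creation_bop: "creation r \<alpha> \<in> carrier (bop H.V)"
  unfolding creation_def using pmap_strip by (intro H.cop_bop H.one_in_bop)

text \<open>Left concatenation represents the monoid of multiwords.  All evaluations of words at the creation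
  tuple, and the commutation relations, reduce to this law.\<close>

lemma creation_mult:
  assumes "length \<alpha> = length \<beta>"
  shows "creation r \<alpha> \<otimes>\<^bsub>bop H.V\<^esub> creation r \<beta> = creation r (mw_append \<alpha> \<beta>)"
proof -
  have one: "\<one>\<^bsub>bop complex_hspace\<^esub> \<otimes>\<^bsub>bop complex_hspace\<^esub> \<one>\<^bsub>bop complex_hspace\<^esub> = \<one>\<^bsub>bop complex_hspace\<^esub>"
    by (rule H.bop_ext) (simp_all add: H.one_in_bop H.mult_in_bop H.bop_apply_simps)
  have "strip \<beta> \<circ>\<^sub>m strip \<alpha> = strip (mw_append \<alpha> \<beta>)"
    using strip_mw_append[OF assms] by auto
  then show ?thesis
    unfolding creation_def
    using H.cop_mult[OF H.one_in_bop H.one_in_bop pmap_strip pmap_strip]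
    by (simp add: one total_length_mw_append[OF assms] power_add del: map_map)
qed

lemma creation_empty: "creation r (replicate k []) = \<one>\<^bsub>bop H.V\<^esub>"
proof -
  have "creation r (replicate k []) = H.cop Some 1 \<one>\<^bsub>bop complex_hspace\<^esub>"
    unfolding creation_def
    by (simp add: sum_list_replicate, rule H.cop_cong) (simp add: strip_empty fock_index_length)
  then show ?thesis by (simp add: H.cop_one)
qed

lemma length_creation_tuple [simp]: "length (creation_tuple r) = k"
  by (simp add: creation_tuple_def)

lemma creation_tuple_nth:
  "i < k \<Longrightarrow> creation_tuple r ! i = map (\<lambda>j. creation r (single k i [j])) [0..<n ! i]"
  by (simp add: creation_tuple_def)

lemma creation_tuple_commuting: "creation_tuple r \<in> commuting_tuples H.V n"
  unfolding commuting_tuples_def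
proof (clarsimp, intro conjI allI impI)
  show "map length (creation_tuple r) = n"
    by (auto simp: creation_tuple_def intro!: nth_equalityI)
  show "set (creation_tuple r ! i) \<subseteq> carrier (bop H.V)" if "i < k" for i
    using that creation_bop by (auto simp: creation_tuple_nth)
  fix s t assume "s < k" "t < k" "s \<noteq> t"
  then show "\<forall>S\<in>set (creation_tuple r ! s). \<forall>T\<in>set (creation_tuple r ! t).
      S \<otimes>\<^bsub>bop H.V\<^esub> T = T \<otimes>\<^bsub>bop H.V\<^esub> S"
    by (auto simp: creation_tuple_nth creation_mult single_commute)
qed

lemma word_op_creation:
  assumes i: "i < k" and w: "set w \<subseteq> {..<n ! i}"
  shows "word_op H.V (creation_tuple r ! i) w = creation r (single k i w)"
  using w
proof (induction w)
  case Nil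
  then show ?case by (simp add: word_op_def op_prod_def single_empty creation_empty)
next
  case (Cons j w)
  have "word_op H.V (creation_tuple r ! i) (j # w) =
      creation r (single k i [j]) \<otimes>\<^bsub>bop H.V\<^esub> word_op H.V (creation_tuple r ! i) w"
    using i Cons.prems by (simp add: word_op_def op_prod_def creation_tuple_nth)
  then show ?case using Cons by (simp add: creation_mult single_append)
qed

text \<open>The ordered product over the components is evaluated from the right: the factors from position \<open>m\<close>
  onwards multiply to the multiword \<open>\<alpha>\<close> with its first \<open>m\<close> components emptied.\<close>

lemma multiword_op_creation:
  assumes \<alpha>: "\<alpha> \<in> multiwords n"
  shows "multiword_op H.V (creation_tuple r) \<alpha> = creation r \<alpha>"
proof -
  have len: "length \<alpha> = k" and ent: "\<And>i. i < k \<Longrightarrow> set (\<alpha> ! i) \<subseteq> {..<n ! i}"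
    using \<alpha> by (auto simp: multiwords_def)
  have map2_eq: "map2 (word_op H.V) (creation_tuple r) \<alpha> = map (\<lambda>i. creation r (single k i (\<alpha> ! i))) [0..<k]"
  proof (rule nth_equalityI)
    fix i assume "i < length (map2 (word_op H.V) (creation_tuple r) \<alpha>)"
    then have "i < k" using len by simp
    then show "map2 (word_op H.V) (creation_tuple r) \<alpha> ! i =
        map (\<lambda>i. creation r (single k i (\<alpha> ! i))) [0..<k] ! i"
      using len ent word_op_creation by simp
  qed (simp add: len)
  define tail where "tail m = map (\<lambda>i. if i < m then [] else \<alpha> ! i) [0..<k]" for m
  have "op_prod H.V (map (\<lambda>i. creation r (single k i (\<alpha> ! i))) [m..<k]) = creation r (tail m)"
    if "m \<le> k" for m
    using that
  proof (induction m rule: inc_induct)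
    case base
    have "tail k = replicate k []" by (rule nth_equalityI) (simp_all add: tail_def)
    then show ?case by (simp add: op_prod_def creation_empty)
  next
    case (step m)
    have "mw_append (single k m (\<alpha> ! m)) (tail (Suc m)) = tail m"
      using step.hyps by (intro nth_equalityI) (auto simp: nth_single tail_def less_Suc_eq)
    moreover have "[m..<k] = m # [Suc m..<k]" using step.hyps by (simp add: upt_conv_Cons)
    moreover have "length (single k m (\<alpha> ! m)) = length (tail (Suc m))" by (simp add: tail_def)
    note creation_mult[OF this, of r]
    ultimately show ?case using step.IH by (simp add: op_prod_def)
  qed
  from this[of 0] have "op_prod H.V (map (\<lambda>i. creation r (single k i (\<alpha> ! i))) [0..<k]) = creation r (tail 0)"
    by simp
  moreover have "tail 0 = \<alpha>" by (rule nth_equalityI) (simp_all add: tail_def len)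
  ultimately show ?thesis by (simp add: multiword_op_def map2_eq)
qed

text \<open>The inverse of \<open>strip \<alpha>\<close> as a partial map; it is undefined where concatenation leaves the truncation.\<close>

definition join :: "nat list list \<Rightarrow> nat list list \<Rightarrow> nat list list option" where
  "join \<alpha> \<delta> = (if mw_append \<alpha> \<delta> \<in> fock_index n N then Some (mw_append \<alpha> \<delta>) else None)"

lemma pmap_join: "L.pmap (join \<alpha>)"
  unfolding L.pmap_def join_def by (auto split: if_splits)

lemma adj_creation:
  assumes "length \<alpha> = k"
  shows "adj H.V (creation r \<alpha>) =
    H.cop (join \<alpha>) (complex_of_real r ^ total_length \<alpha>) \<one>\<^bsub>bop complex_hspace\<^esub>"
proof -
  have "strip \<alpha> \<gamma> = Some \<delta> \<longleftrightarrow> join \<alpha> \<delta> = Some \<gamma>"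
    if "\<gamma> \<in> fock_index n N" "\<delta> \<in> fock_index n N" for \<gamma> \<delta>
    using that assms fock_index_length[OF that(2)] by (auto simp: strip_eq_Some_iff join_def)
  then show ?thesis
    unfolding creation_def using H.adj_cop[OF pmap_strip pmap_join] by simp
qed

lemma creation_adj_in:
  "length \<alpha> = k \<Longrightarrow> creation r \<alpha> \<otimes>\<^bsub>bop H.V\<^esub> adj H.V (creation r \<alpha>) \<in> carrier (bop H.V)"
  using pmap_join adj_creation by (simp add: H.V.mult_in_bop creation_bop H.cop_bop H.one_in_bop)

text \<open>Deleting \<open>\<alpha>\<close> and prepending it again gives back coordinate \<open>\<gamma>\<close> if \<open>\<gamma>\<close> starts with \<open>\<alpha>\<close>,
  and \<open>0\<close> otherwise; the scalar occurs twice.\<close>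

lemma co_creation_adj:
  assumes \<alpha>: "length \<alpha> = k" and y: "y \<in> carrier H.V" and \<gamma>: "\<gamma> \<in> fock_index n N"
  shows "cmod (H.co ((creation r \<alpha> \<otimes>\<^bsub>bop H.V\<^esub> adj H.V (creation r \<alpha>)) y) \<gamma>)
    \<le> (r ^ total_length \<alpha>)\<^sup>2 * cmod (H.co y \<gamma>)"
proof -
  define z where "z = adj H.V (creation r \<alpha>) y"
  have z: "z \<in> carrier H.V"
    unfolding z_def adj_creation[OF \<alpha>] using H.one_in_bop pmap_join y by (rule H.cop_in)
  have eq: "H.co ((creation r \<alpha> \<otimes>\<^bsub>bop H.V\<^esub> adj H.V (creation r \<alpha>)) y) \<gamma> =
      (case strip \<alpha> \<gamma> of None \<Rightarrow> 0 | Some \<delta> \<Rightarrow> complex_of_real r ^ total_length \<alpha> * H.co z \<delta>)"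
    unfolding H.V.bop_apply_simps(4)[OF y] z_def[symmetric]
    unfolding creation_def H.co_cop[OF H.one_in_bop pmap_strip z \<gamma>]
    by (simp add: H.bop_apply_simps split: option.split)
  show ?thesis
  proof (cases "strip \<alpha> \<gamma>")
    case None
    then show ?thesis by (simp add: eq)
  next
    case (Some \<delta>)
    then have "join \<alpha> \<delta> = Some \<gamma>" using \<gamma> by (auto simp: strip_eq_Some_iff join_def)
    then have "H.co z \<delta> = complex_of_real r ^ total_length \<alpha> * H.co y \<gamma>"
      using H.co_cop[OF H.one_in_bop pmap_join y strip_fock_index[OF \<gamma> Some]]
      by (simp add: z_def adj_creation[OF \<alpha>] H.bop_apply_simps)
    then show ?thesis using Some power_abs[of r "total_length \<alpha>", symmetric]
      by (simp add: eq norm_mult norm_power power2_eq_square flip: mult.assoc)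
  qed
qed

text \<open>The terms are diagonal with entries at most \<open>r ^ (2|q|)\<close>, so it suffices to count them.  The growth
  argument uses the exponent of \<open>r\<close>; any constant factor will do.\<close>

lemma opnorm_row:
  assumes q: "length q = k"
  shows "opnorm H.V (\<Oplus>\<^bsub>bop H.V\<^esub>\<alpha>\<in>multiwords_of_length n q.
      multiword_op H.V (creation_tuple r) \<alpha> \<otimes>\<^bsub>bop H.V\<^esub> adj H.V (multiword_op H.V (creation_tuple r) \<alpha>))
    \<le> real (card (multiwords_of_length n q)) * (r ^ sum_list q)\<^sup>2"
proof -
  let ?S = "multiwords_of_length n q"
  let ?C = "\<lambda>\<alpha>. creation r \<alpha> \<otimes>\<^bsub>bop H.V\<^esub> adj H.V (creation r \<alpha>)"
  let ?Q = "\<Oplus>\<^bsub>bop H.V\<^esub>\<alpha>\<in>?S. ?C \<alpha>"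
  interpret BH: abelian_group "bop H.V" by (rule H.V.abelian_group_bop)
  have S: "length \<alpha> = k" "total_length \<alpha> = sum_list q" "\<alpha> \<in> multiwords n" if "\<alpha> \<in> ?S" for \<alpha>
    using that by (auto simp: multiwords_of_length_def multiwords_def)
  have Q: "?Q \<in> carrier (bop H.V)"
    by (rule BH.finsum_closed) (use S creation_adj_in in auto)
  have "opnorm H.V ?Q \<le> real (card ?S) * (r ^ sum_list q)\<^sup>2"
  proof (rule H.V.opnorm_le)
    fix y assume y: "y \<in> carrier H.V"
    have C: "?C \<alpha> y \<in> carrier H.V" if "\<alpha> \<in> ?S" for \<alpha>
      using H.V.bop_closed[OF creation_adj_in y] S that by blast
    have Qy: "?Q y = (\<Oplus>\<^bsub>H.V\<^esub>\<alpha>\<in>?S. ?C \<alpha> y)"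
      by (rule H.V.finsum_apply[OF y]) (use S creation_adj_in in auto)
    show "hnorm H.V (?Q y) \<le> real (card ?S) * (r ^ sum_list q)\<^sup>2 * hnorm H.V y"
    proof (rule H.hnorm_power_mono)
      fix \<gamma> assume \<gamma>: "\<gamma> \<in> fock_index n N"
      have "H.co (?Q y) \<gamma> = (\<Sum>\<alpha>\<in>?S. H.co (?C \<alpha> y) \<gamma>)"
        unfolding Qy finsum_complex[symmetric] by (rule H.co_finsum) (use C \<gamma> in auto)
      then have "cmod (H.co (?Q y) \<gamma>) \<le> (\<Sum>\<alpha>\<in>?S. cmod (H.co (?C \<alpha> y) \<gamma>))"
        by (simp add: norm_sum)
      also have "\<dots> \<le> (\<Sum>\<alpha>\<in>?S. (r ^ sum_list q)\<^sup>2 * cmod (H.co y \<gamma>))"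
        using co_creation_adj[OF _ y \<gamma>, of _ r] S by (intro sum_mono) metis
      finally show "hnorm complex_hspace (H.co (?Q y) \<gamma>) \<le>
          real (card ?S) * (r ^ sum_list q)\<^sup>2 * hnorm complex_hspace (H.co y \<gamma>)"
        by simp
    qed (use y H.V.bop_closed[OF Q y] in auto)
  qed simp
  also have "?Q = (\<Oplus>\<^bsub>bop H.V\<^esub>\<alpha>\<in>?S. multiword_op H.V (creation_tuple r) \<alpha>
      \<otimes>\<^bsub>bop H.V\<^esub> adj H.V (multiword_op H.V (creation_tuple r) \<alpha>))"
    by (rule finsum_cong_plain) (use S multiword_op_creation in simp)
  finally show ?thesis .
qed

end

section \<open>Values of power series\<close>

text \<open>If only finitely many homogeneous parts are nonzero, then the net of partial sums is eventually
  constant.  The operator norm separates operators, so its limit is the only value.\<close>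

lemma value_at_finite:
  assumes L: "hilbert_space L"
    and P0: "finite P0" "P0 \<subseteq> {p. length p = length n}"
    and closed: "\<And>p. homogeneous_part K H L \<tau> n A X p \<in> carrier (bop L)"
    and zero: "\<And>p. length p = length n \<Longrightarrow> p \<notin> P0 \<Longrightarrow> homogeneous_part K H L \<tau> n A X p = \<zero>\<^bsub>bop L\<^esub>"
  shows "value_at K H L \<tau> n A X = (\<Oplus>\<^bsub>bop L\<^esub>p\<in>P0. homogeneous_part K H L \<tau> n A X p)"
proof -
  interpret L: hilbert_space L by fact
  interpret B: abelian_group "bop L" by (rule L.abelian_group_bop)
  let ?F = "finite_subsets_at_top {p. length p = length n}"
  let ?s = "\<lambda>P. \<Oplus>\<^bsub>bop L\<^esub>p\<in>P. homogeneous_part K H L \<tau> n A X p"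
  have s: "?s P \<in> carrier (bop L)" for P
    by (rule B.finsum_closed) (use closed in auto)
  have s_eq: "?s P = ?s P0" if "finite P" "P0 \<subseteq> P" "P \<subseteq> {p. length p = length n}" for P
    by (rule B.add.finprod_mono_neutral_cong_left[symmetric]) (use that closed zero in auto)
  have ev: "eventually (\<lambda>P. opnorm L (?s P \<ominus>\<^bsub>bop L\<^esub> T) = opnorm L (?s P0 \<ominus>\<^bsub>bop L\<^esub> T)) ?F" for T
    unfolding eventually_finite_subsets_at_top
    by (rule exI[of _ P0]) (metis P0 s_eq)
  have lim: "((\<lambda>P. opnorm L (?s P \<ominus>\<^bsub>bop L\<^esub> T)) \<longlongrightarrow> opnorm L (?s P0 \<ominus>\<^bsub>bop L\<^esub> T)) ?F" for T
    by (rule tendsto_eventually[OF ev])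
  have self: "opnorm L (?s P0 \<ominus>\<^bsub>bop L\<^esub> ?s P0) = 0"
    using s[of P0] by (simp add: a_minus_def B.r_neg L.opnorm_zero)
  show ?thesis
    unfolding value_at_def
  proof (rule the_equality)
    show "has_value K H L \<tau> n A X (?s P0)"
      unfolding has_value_def using lim[of "?s P0"] s[of P0] by (simp only: self simp_thms)
    fix T assume T: "has_value K H L \<tau> n A X T"
    then have "opnorm L (?s P0 \<ominus>\<^bsub>bop L\<^esub> T) = 0"
      unfolding has_value_def using lim[of T] tendsto_unique[OF finite_subsets_at_top_neq_bot] by blast
    then have "?s P0 = T"
      using T s[of P0] by (intro L.opnorm_diff_eq_0) (auto simp: has_value_def)
    then show "T = ?s P0" by (rule sym)
  qed
qed

lemma growth_imp_zero:
  fixes a :: real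
  assumes "0 \<le> a" and "d < D" and le: "\<And>r. 1 \<le> r \<Longrightarrow> r ^ D * a \<le> M * r ^ d"
  shows "a = 0"
proof (rule ccontr)
  assume "a \<noteq> 0"
  then have a: "a > 0" using assms(1) by simp
  \<comment> \<open>For this \<open>r\<close>, one additional factor \<open>r\<close> already outweighs the constant \<open>M\<close>.\<close>
  define r where "r = max 1 ((\<bar>M\<bar> + 1) / a)"
  have r: "1 \<le> r" "(\<bar>M\<bar> + 1) / a \<le> r" by (auto simp: r_def)
  then have "\<bar>M\<bar> + 1 \<le> r * a" using a by (simp add: pos_divide_le_eq)
  moreover have "r * a \<le> M"
  proof -
    have "r ^ d * (r * a) = r ^ Suc d * a" by simp
    also have "\<dots> \<le> r ^ D * a"
      using r assms(1,2) by (intro mult_right_mono power_increasing) auto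
    also have "\<dots> \<le> r ^ d * M" using le[OF r(1)] by (simp add: mult.commute)
    finally show ?thesis using r by (subst (asm) mult_le_cancel_left_pos) auto
  qed
  ultimately show False by linarith
qed

context truncated_fock begin

definition vacuum :: 'h where
  "vacuum = basis (replicate k [])"

lemma homogeneous_part_creation:
  assumes A: "A \<in> multiwords n \<rightarrow> carrier (bop K)"
  shows "homogeneous_part K H.V L.V \<tau> n A (creation_tuple r) p =
    (\<Oplus>\<^bsub>bop L.V\<^esub>\<alpha>\<in>multiwords_of_length n p. L.cop (strip \<alpha>) (complex_of_real r ^ total_length \<alpha>) (A \<alpha>))"
  unfolding homogeneous_part_def
proof (rule finsum_cong_plain)
  fix \<alpha> assume "\<alpha> \<in> multiwords_of_length n p"
  then have \<alpha>: "\<alpha> \<in> multiwords n" by (simp add: multiwords_of_length_def)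
  then have "A \<alpha> \<in> carrier (bop K)" using A by auto
  then show "op_tensor K H.V L.V \<tau> (A \<alpha>) (multiword_op H.V (creation_tuple r) \<alpha>) =
      L.cop (strip \<alpha>) (complex_of_real r ^ total_length \<alpha>) (A \<alpha>)"
    unfolding multiword_op_creation[OF \<alpha>] creation_def using pmap_strip by (rule op_tensor_cop)
qed

text \<open>Nilpotency: a multiword that is longer than the truncation is not a prefix of any index.\<close>

lemma cop_strip_long:
  assumes "A \<in> carrier (bop K)" "N < total_length \<alpha>"
  shows "L.cop (strip \<alpha>) c A = \<zero>\<^bsub>bop L.V\<^esub>"
proof -
  interpret BL: abelian_group "bop L.V" by (rule L.V.abelian_group_bop)
  have none: "strip \<alpha> \<gamma> = None" if \<gamma>: "\<gamma> \<in> fock_index n N" for \<gamma>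
  proof (rule ccontr)
    assume "strip \<alpha> \<gamma> \<noteq> None"
    then obtain \<delta> where "length \<delta> = length \<alpha>" "\<gamma> = mw_append \<alpha> \<delta>"
      by (auto simp: strip_eq_Some_iff)
    then have "total_length \<alpha> \<le> total_length \<gamma>" by (simp add: total_length_mw_append del: map_map)
    then show False using \<gamma> assms(2) by (simp add: fock_index_def)
  qed
  show ?thesis
  proof (rule L.V.bop_ext)
    show "L.cop (strip \<alpha>) c A \<in> carrier (bop L.V)" using assms(1) pmap_strip by (rule L.cop_bop)
    fix z assume z: "z \<in> carrier L.V"
    show "L.cop (strip \<alpha>) c A z = \<zero>\<^bsub>bop L.V\<^esub> z"
      unfolding L.V.bop_apply_simps(1)[OF z]
      by (rule L.co_ext)
        (simp_all add: L.cop_in[OF assms(1) pmap_strip z] L.co_cop[OF assms(1) pmap_strip z]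
          L.power_closed L.co_zero none)
  qed simp
qed

lemma value_at_creation:
  assumes A: "A \<in> multiwords n \<rightarrow> carrier (bop K)"
  shows "value_at K H.V L.V \<tau> n A (creation_tuple r) =
      (\<Oplus>\<^bsub>bop L.V\<^esub>p\<in>{p. length p = k \<and> sum_list p \<le> N}.
        \<Oplus>\<^bsub>bop L.V\<^esub>\<alpha>\<in>multiwords_of_length n p. L.cop (strip \<alpha>) (complex_of_real r ^ total_length \<alpha>) (A \<alpha>))"
    (is "_ = (\<Oplus>\<^bsub>bop L.V\<^esub>p\<in>?P. _ p)")
  unfolding homogeneous_part_creation[OF A, symmetric]
proof (rule value_at_finite)
  interpret BL: abelian_group "bop L.V" by (rule L.V.abelian_group_bop)
  show "hilbert_space L.V" by (rule L.hilbert_space_power)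
  show "finite ?P"
  proof (rule finite_subset)
    show "?P \<subseteq> {p. set p \<subseteq> {..N} \<and> length p = k}"
      by (auto intro: order_trans[OF member_le_sum_list])
    show "finite {p. set p \<subseteq> {..N} \<and> length p = k}" by (rule finite_lists_length_eq) simp
  qed
  show "?P \<subseteq> {p. length p = k}" by auto
  have A': "A \<alpha> \<in> carrier (bop K)" if "\<alpha> \<in> multiwords_of_length n p" for \<alpha> p
    using A that by (auto simp: multiwords_of_length_def)
  show "homogeneous_part K H.V L.V \<tau> n A (creation_tuple r) p \<in> carrier (bop L.V)" for p
    unfolding homogeneous_part_creation[OF A]
    by (rule BL.finsum_closed) (use A' L.cop_bop pmap_strip in auto)
  fix p assume "length p = k" "p \<notin> ?P"
  then have p: "N < sum_list p" by auto
  have "homogeneous_part K H.V L.V \<tau> n A (creation_tuple r) p =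
      (\<Oplus>\<^bsub>bop L.V\<^esub>\<alpha>\<in>multiwords_of_length n p. \<zero>\<^bsub>bop L.V\<^esub>)"
    unfolding homogeneous_part_creation[OF A]
  proof (rule finsum_cong_plain)
    fix \<alpha> assume \<alpha>: "\<alpha> \<in> multiwords_of_length n p"
    then have "N < total_length \<alpha>" using p by (simp add: multiwords_of_length_def)
    then show "L.cop (strip \<alpha>) (complex_of_real r ^ total_length \<alpha>) (A \<alpha>) = \<zero>\<^bsub>bop L.V\<^esub>"
      using A'[OF \<alpha>] by (intro cop_strip_long)
  qed
  then show "homogeneous_part K H.V L.V \<tau> n A (creation_tuple r) p = \<zero>\<^bsub>bop L.V\<^esub>"
    by (simp add: BL.finsum_zero)
qed

text \<open>Left concatenation with \<open>\<alpha>\<close> turns the empty multiword into \<open>\<alpha>\<close>, so distinct multiwords put their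
  coefficients into distinct coordinates.\<close>

lemma co_cop_vacuum:
  assumes A: "A \<in> carrier (bop K)" and x: "x \<in> carrier K" and \<gamma>: "\<gamma> \<in> fock_index n N"
    and \<alpha>: "length \<alpha> = k"
  shows "L.co (L.cop (strip \<alpha>) c A (\<tau> x vacuum)) \<gamma> = (if \<gamma> = \<alpha> then c \<odot> A x else \<zero>)"
proof -
  have co: "L.co (\<tau> x vacuum) \<delta> = (if \<delta> = replicate k [] then x else \<zero>)"
    if "\<delta> \<in> fock_index n N" for \<delta>
    using that x L.smult_one[OF x] L.smult_l_null[OF x] by (simp add: co_\<tau> vacuum_def co_basis)
  have "strip \<alpha> \<gamma> = Some (replicate k []) \<longleftrightarrow> \<gamma> = \<alpha>"
    using \<alpha> mw_append_empty[OF \<alpha>] by (auto simp: strip_eq_Some_iff)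
  then show ?thesis
    using L.co_cop[OF A pmap_strip \<tau>_in[OF x] \<gamma>, of \<alpha> c vacuum] co strip_fock_index[OF \<gamma>]
      L.bop_zero_image[OF A]
    by (auto split: option.split)
qed

lemma co_value_vacuum:
  assumes A: "A \<in> multiwords n \<rightarrow> carrier (bop K)" and x: "x \<in> carrier K"
    and \<gamma>: "\<gamma> \<in> fock_index n N"
  shows "L.co (value_at K H.V L.V \<tau> n A (creation_tuple r) (\<tau> x vacuum)) \<gamma> =
    complex_of_real r ^ total_length \<gamma> \<odot> A \<gamma> x"
proof -
  interpret BL: abelian_group "bop L.V" by (rule L.V.abelian_group_bop)
  let ?P = "{p. length p = k \<and> sum_list p \<le> N}"
  let ?v = "\<tau> x vacuum"
  let ?C = "\<lambda>\<alpha>. L.cop (strip \<alpha>) (complex_of_real r ^ total_length \<alpha>) (A \<alpha>)"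
  let ?R = "complex_of_real r ^ total_length \<gamma> \<odot> A \<gamma> x"
  have v: "?v \<in> carrier L.V" using x by (rule \<tau>_in)
  have S: "A \<alpha> \<in> carrier (bop K)" "length \<alpha> = k" "map length \<alpha> = p" "?C \<alpha> \<in> carrier (bop L.V)"
    "?C \<alpha> ?v \<in> carrier L.V" if "\<alpha> \<in> multiwords_of_length n p" for \<alpha> p
  proof -
    show *: "A \<alpha> \<in> carrier (bop K)" "length \<alpha> = k" "map length \<alpha> = p"
      using A that by (auto simp: multiwords_of_length_def multiwords_def)
    show "?C \<alpha> \<in> carrier (bop L.V)" using *(1) pmap_strip by (rule L.cop_bop)
    then show "?C \<alpha> ?v \<in> carrier L.V" using v by (rule L.V.bop_closed)
  qed
  have \<gamma>_mw: "\<gamma> \<in> multiwords n" "total_length \<gamma> \<le> N" "length \<gamma> = k"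
    using \<gamma> by (auto simp: fock_index_def multiwords_def)
  have R: "?R \<in> carrier K"
    by (intro L.smult_in L.bop_closed[OF _ x]) (use A \<gamma>_mw in auto)
  have inner: "(\<Oplus>\<^bsub>bop L.V\<^esub>\<alpha>\<in>multiwords_of_length n p. ?C \<alpha>) \<in> carrier (bop L.V)" for p
    by (rule BL.finsum_closed) (use S in auto)
  have co_inner: "L.co ((\<Oplus>\<^bsub>bop L.V\<^esub>\<alpha>\<in>multiwords_of_length n p. ?C \<alpha>) ?v) \<gamma> =
      (if map length \<gamma> = p then ?R else \<zero>)" for p
  proof -
    have "(\<Oplus>\<^bsub>bop L.V\<^esub>\<alpha>\<in>multiwords_of_length n p. ?C \<alpha>) ?v =
        (\<Oplus>\<^bsub>L.V\<^esub>\<alpha>\<in>multiwords_of_length n p. ?C \<alpha> ?v)"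
      by (rule L.V.finsum_apply[OF v]) (use S in auto)
    then have "L.co ((\<Oplus>\<^bsub>bop L.V\<^esub>\<alpha>\<in>multiwords_of_length n p. ?C \<alpha>) ?v) \<gamma> =
        (\<Oplus>\<alpha>\<in>multiwords_of_length n p. L.co (?C \<alpha> ?v) \<gamma>)"
      using L.co_finsum[of "multiwords_of_length n p" "\<lambda>\<alpha>. ?C \<alpha> ?v" \<gamma>] S(5) \<gamma> by simp
    also have "\<dots> = (\<Oplus>\<alpha>\<in>multiwords_of_length n p. if \<gamma> = \<alpha> then ?R else \<zero>)"
      by (rule finsum_cong_plain) (use co_cop_vacuum[OF S(1) x \<gamma> S(2)] in auto)
    also have "\<dots> = (if map length \<gamma> = p then ?R else \<zero>)"
    proof (cases "map length \<gamma> = p")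
      case True
      then have "\<gamma> \<in> multiwords_of_length n p" using \<gamma>_mw by (simp add: multiwords_of_length_def)
      then show ?thesis
        using L.M.finsum_singleton[of \<gamma> "multiwords_of_length n p" "\<lambda>_. ?R"] R True
        by (simp add: finite_multiwords_of_length)
    next
      case False
      then have "(\<Oplus>\<alpha>\<in>multiwords_of_length n p. if \<gamma> = \<alpha> then ?R else \<zero>) =
          (\<Oplus>\<alpha>\<in>multiwords_of_length n p. \<zero>)"
        using S(3) by (intro finsum_cong_plain) auto
      then show ?thesis using False by (simp add: L.M.finsum_zero)
    qed
    finally show ?thesis .
  qed
  have P: "finite ?P"
    by (rule finite_subset[OF _ finite_lists_length_eq[of "{..N}" k]])
      (auto intro: order_trans[OF member_le_sum_list])
  have "value_at K H.V L.V \<tau> n A (creation_tuple r) ?v =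
      (\<Oplus>\<^bsub>L.V\<^esub>p\<in>?P. (\<Oplus>\<^bsub>bop L.V\<^esub>\<alpha>\<in>multiwords_of_length n p. ?C \<alpha>) ?v)"
    unfolding value_at_creation[OF A] by (rule L.V.finsum_apply[OF v]) (rule inner)
  then have "L.co (value_at K H.V L.V \<tau> n A (creation_tuple r) ?v) \<gamma> =
      (\<Oplus>p\<in>?P. L.co ((\<Oplus>\<^bsub>bop L.V\<^esub>\<alpha>\<in>multiwords_of_length n p. ?C \<alpha>) ?v) \<gamma>)"
    using L.co_finsum[of ?P "\<lambda>p. (\<Oplus>\<^bsub>bop L.V\<^esub>\<alpha>\<in>multiwords_of_length n p. ?C \<alpha>) ?v" \<gamma>]
      L.V.bop_closed[OF inner v] \<gamma> by simp
  also have "\<dots> = (\<Oplus>p\<in>?P. if map length \<gamma> = p then ?R else \<zero>)"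
    by (rule finsum_cong_plain) (rule co_inner)
  also have "\<dots> = ?R"
    using L.M.finsum_singleton[of "map length \<gamma>" ?P "\<lambda>_. ?R"] R P \<gamma>_mw by simp
  finally show ?thesis .
qed

text \<open>One coordinate of the value at \<open>x \<otimes> e\<close> already contains \<open>A\<^sub>\<gamma> x\<close> with the factor \<open>r ^ |\<gamma>|\<close>; no other
  homogeneous part interferes, so growth of order \<open>d < |\<gamma>|\<close> is incompatible with \<open>A\<^sub>\<gamma> x \<noteq> 0\<close>.\<close>

theorem coefficient_eq_zero:
  assumes A: "A \<in> multiwords n \<rightarrow> carrier (bop K)"
    and bound: "\<And>r. 1 \<le> r \<Longrightarrow> opnorm L.V (value_at K H.V L.V \<tau> n A (creation_tuple r)) \<le> M * r ^ d"
    and \<gamma>: "\<gamma> \<in> fock_index n N" and d: "d < total_length \<gamma>"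
  shows "A \<gamma> = \<zero>\<^bsub>bop K\<^esub>"
proof (rule L.bop_ext)
  interpret BK: abelian_group "bop K" by (rule L.abelian_group_bop)
  interpret BL: abelian_group "bop L.V" by (rule L.V.abelian_group_bop)
  show A\<gamma>: "A \<gamma> \<in> carrier (bop K)" using A \<gamma> by (auto simp: fock_index_def)
  show "\<zero>\<^bsub>bop K\<^esub> \<in> carrier (bop K)" by simp
  fix x assume x: "x \<in> carrier K"
  define v where "v = \<tau> x vacuum"
  have v: "v \<in> carrier L.V" unfolding v_def using x by (rule \<tau>_in)
  have Ax: "A \<gamma> x \<in> carrier K" using A\<gamma> x by (rule L.bop_closed)
  have "r ^ total_length \<gamma> * hnorm K (A \<gamma> x) \<le> M * hnorm L.V v * r ^ d" if r: "1 \<le> r" for r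
  proof -
    let ?F = "value_at K H.V L.V \<tau> n A (creation_tuple r)"
    have F: "?F \<in> carrier (bop L.V)"
      unfolding value_at_creation[OF A]
      by (intro BL.finsum_closed Pi_I L.cop_bop pmap_strip)
        (use A in \<open>auto simp: multiwords_of_length_def\<close>)
    have "r ^ total_length \<gamma> * hnorm K (A \<gamma> x) = hnorm K (L.co (?F v) \<gamma>)"
      using r Ax by (simp add: v_def co_value_vacuum[OF A x \<gamma>] L.hnorm_smult norm_power)
    also have "\<dots> \<le> hnorm L.V (?F v)"
      using L.V.bop_closed[OF F v] \<gamma> by (rule L.hnorm_co_le)
    also have "\<dots> \<le> opnorm L.V ?F * hnorm L.V v" using F v by (rule L.V.hnorm_le_opnorm)
    also have "\<dots> \<le> M * r ^ d * hnorm L.V v"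
      using bound[OF r] L.V.hnorm_nonneg[OF v] by (rule mult_right_mono)
    finally show ?thesis by (simp add: mult_ac)
  qed
  then have "hnorm K (A \<gamma> x) = 0"
    using L.hnorm_nonneg[OF Ax] d by (intro growth_imp_zero)
  then show "A \<gamma> x = \<zero>\<^bsub>bop K\<^esub> x"
    using L.hnorm_eq_0_iff[OF Ax] x by (simp add: L.bop_apply_simps)
qed

end

section \<open>Polynomials and constants\<close>

text \<open>An infinite type maps onto the countable set of all multiwords, and pulling back along this
  surjection embeds the families indexed by multiwords.\<close>

lemma ex_inj_coordinates:
  "\<exists>J :: (nat list list \<Rightarrow> complex) \<Rightarrow> ('u::infinite \<Rightarrow> complex). inj J"
proof -
  obtain h :: "nat \<Rightarrow> 'u" where h: "inj h"
    using infinite_countable_subset[OF infinite_UNIV] by blast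
  define e :: "'u \<Rightarrow> nat list list" where "e = (\<lambda>u. from_nat (inv_into UNIV h u))"
  have e: "e (h (to_nat w)) = w" for w using h by (simp add: e_def)
  have "inj (\<lambda>f u. f (e u) :: complex)"
  proof (rule injI)
    fix f g :: "nat list list \<Rightarrow> complex" assume eq: "(\<lambda>u. f (e u)) = (\<lambda>u. g (e u))"
    show "f = g"
    proof (rule ext)
      show "f w = g w" for w using fun_cong[OF eq, of "h (to_nat w)"] by (simp add: e)
    qed
  qed
  then show ?thesis by blast
qed

text \<open>A vector is encoded by the functional that it induces, and its index by some function \<open>'u \<Rightarrow> complex\<close>
  that has the number of the multiword as a value.\<close>

lemma (in hilbert_space) ex_inj_vector_coordinates:
  "\<exists>J :: (nat list list \<Rightarrow> 'a) \<Rightarrow> ('a \<times> ('u \<Rightarrow> complex) \<Rightarrow> complex). inj_on J (B \<rightarrow>\<^sub>E carrier H)"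
proof -
  define e :: "('u \<Rightarrow> complex) \<Rightarrow> nat list list" where "e y = from_nat (nat \<lfloor>Re (y undefined)\<rfloor>)" for y
  have e: "e (\<lambda>_. of_nat (to_nat w)) = w" for w by (simp add: e_def)
  have "inj_on (\<lambda>f (x, y). hinner H (f (e y)) x) (B \<rightarrow>\<^sub>E carrier H)"
  proof (rule inj_onI)
    fix f g assume f: "f \<in> B \<rightarrow>\<^sub>E carrier H" and g: "g \<in> B \<rightarrow>\<^sub>E carrier H"
      and eq: "(\<lambda>(x, y). hinner H (f (e y)) x) = (\<lambda>(x, y). hinner H (g (e y)) x)"
    show "f = g"
    proof (rule PiE_ext[OF f g])
      fix b assume b: "b \<in> B"
      then have fb: "f b \<in> carrier H" "g b \<in> carrier H" using f g by auto
      show "f b = g b"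
      proof (rule hinner_ext[OF fb])
        fix x assume x: "x \<in> carrier H"
        have "hinner H (f b) x = hinner H (g b) x"
          using fun_cong[OF eq, of "(x, \<lambda>_. of_nat (to_nat b))"] by (simp add: e)
        then show "hinner H x (f b) = hinner H x (g b)"
          using hinner_commute[OF fb(1) x] hinner_commute[OF fb(2) x] by simp
      qed
    qed
  qed
  then show ?thesis by blast
qed

lemma ex_truncated_fock:
  fixes K :: "'k hspace"
  assumes "hilbert_space K"
  shows "\<exists>(J' :: (nat list list \<Rightarrow> 'k) \<Rightarrow> ('k \<times> ('u::infinite universe) \<Rightarrow> complex))
      (J :: (nat list list \<Rightarrow> complex) \<Rightarrow> 'u universe). truncated_fock K J' n N J"
proof -
  obtain J :: "(nat list list \<Rightarrow> complex) \<Rightarrow> 'u universe" where J: "inj J"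
    using ex_inj_coordinates by blast
  obtain J' :: "(nat list list \<Rightarrow> 'k) \<Rightarrow> ('k \<times> 'u universe \<Rightarrow> complex)"
    where J': "inj_on J' (fock_index n N \<rightarrow>\<^sub>E carrier K)"
    using hilbert_space.ex_inj_vector_coordinates[OF assms] by blast
  have "truncated_fock K J' n N J"
    by (intro truncated_fock.intro power_tensor.intro hilbert_power.intro hilbert_power_axioms.intro)
      (use assms hilbert_space_complex finite_fock_index J' inj_on_subset[OF J] in auto)
  then show ?thesis by blast
qed

lemma coefficient_eq_zero_of_growth_bound:
  fixes K :: "'k hspace"
  assumes K: "hilbert_space K" and A: "A \<in> multiwords n \<rightarrow> carrier (bop K)"
    and bound: "growth_bound TYPE('u::infinite universe) K n A C q"
    and C: "0 \<le> C" and q: "length q = length n"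
    and \<alpha>: "\<alpha> \<in> multiwords n" "sum_list q < total_length \<alpha>"
  shows "A \<alpha> = \<zero>\<^bsub>bop K\<^esub>"
proof -
  obtain J' :: "(nat list list \<Rightarrow> 'k) \<Rightarrow> ('k \<times> 'u universe \<Rightarrow> complex)"
    and J :: "(nat list list \<Rightarrow> complex) \<Rightarrow> 'u universe"
    where "truncated_fock K J' n (total_length \<alpha>) J"
    using ex_truncated_fock[OF K] by blast
  then interpret truncated_fock K J' n "total_length \<alpha>" J .
  define c where "c = real (card (multiwords_of_length n q))"
  show ?thesis
  proof (rule coefficient_eq_zero[OF A])
    fix r :: real assume r: "1 \<le> r"
    let ?Q = "opnorm H.V (\<Oplus>\<^bsub>bop H.V\<^esub>\<beta>\<in>multiwords_of_length n q.
      multiword_op H.V (creation_tuple r) \<beta> \<otimes>\<^bsub>bop H.V\<^esub> adj H.V (multiword_op H.V (creation_tuple r) \<beta>))"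
    have "opnorm L.V (value_at K H.V L.V \<tau> n A (creation_tuple r)) \<le> C * sqrt ?Q"
      using bound hilbert_tensor_power creation_tuple_commuting unfolding growth_bound_def by blast
    also have "\<dots> \<le> C * sqrt (c * (r ^ sum_list q)\<^sup>2)"
      unfolding c_def using C opnorm_row[OF q] by (intro mult_left_mono real_sqrt_le_mono)
    also have "\<dots> = C * sqrt c * r ^ sum_list q"
      using r by (simp add: real_sqrt_mult)
    finally show "opnorm L.V (value_at K H.V L.V \<tau> n A (creation_tuple r)) \<le> C * sqrt c * r ^ sum_list q" .
  next
    show "\<alpha> \<in> fock_index n (total_length \<alpha>)" using \<alpha>(1) by (simp add: fock_index_def)
  qed (rule \<alpha>(2))
qed

lemma coefficient_eq_zero_of_bounded:
  fixes K :: "'k hspace"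
  assumes K: "hilbert_space K" and A: "A \<in> multiwords n \<rightarrow> carrier (bop K)"
    and bounded: "bounded_function TYPE('u::infinite universe) K n A"
    and \<alpha>: "\<alpha> \<in> multiwords n" "0 < total_length \<alpha>"
  shows "A \<alpha> = \<zero>\<^bsub>bop K\<^esub>"
proof -
  obtain J' :: "(nat list list \<Rightarrow> 'k) \<Rightarrow> ('k \<times> 'u universe \<Rightarrow> complex)"
    and J :: "(nat list list \<Rightarrow> complex) \<Rightarrow> 'u universe"
    where "truncated_fock K J' n (total_length \<alpha>) J"
    using ex_truncated_fock[OF K] by blast
  then interpret truncated_fock K J' n "total_length \<alpha>" J .
  obtain M where M: "opnorm L.V (value_at K H.V L.V \<tau> n A (creation_tuple r)) \<le> M" for r
    using bounded hilbert_tensor_power creation_tuple_commuting unfolding bounded_function_def by metis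
  show ?thesis
  proof (rule coefficient_eq_zero[OF A])
    show "opnorm L.V (value_at K H.V L.V \<tau> n A (creation_tuple r)) \<le> M * r ^ 0" for r
      using M by simp
    show "\<alpha> \<in> fock_index n (total_length \<alpha>)" using \<alpha>(1) by (simp add: fock_index_def)
  qed (rule \<alpha>(2))
qed

lemma (in hilbert_space) op_prod_bop:
  "set Ts \<subseteq> carrier (bop H) \<Longrightarrow> op_prod H Ts \<in> carrier (bop H)"
  by (induction Ts) (auto simp: op_prod_def one_in_bop mult_in_bop)

lemma (in hilbert_space) multiword_op_bop:
  assumes X: "X \<in> commuting_tuples H n" and \<alpha>: "\<alpha> \<in> multiwords n"
  shows "multiword_op H X \<alpha> \<in> carrier (bop H)"
  unfolding multiword_op_def
proof (rule op_prod_bop, clarsimp simp: in_set_zip)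
  have len: "map length X = n" using X by (simp add: commuting_tuples_def)
  fix i assume i: "i < length X" "i < length \<alpha>"
  then have n: "i < length n" "length (X ! i) = n ! i" using len by auto
  show "word_op H (X ! i) (\<alpha> ! i) \<in> carrier (bop H)"
    unfolding word_op_def
  proof (rule op_prod_bop, clarsimp)
    fix j assume "j \<in> set (\<alpha> ! i)"
    then have "j < n ! i" using \<alpha> n by (auto simp: multiwords_def)
    then have "X ! i ! j \<in> set (X ! i)" using n by simp
    then show "X ! i ! j \<in> carrier (bop H)" using X n by (auto simp: commuting_tuples_def)
  qed
qed

text \<open>The two descriptions select among the same operators, because \<open>0 \<otimes> y = 0\<close> for every \<open>y\<close>.  The
  operator \<open>0\<close> satisfies them both.\<close>

lemma op_tensor_zero_cong:
  assumes L: "hilbert_tensor K H L \<tau>" and T: "T \<in> carrier (bop H)" and T': "T' \<in> carrier (bop H)"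
  shows "op_tensor K H L \<tau> \<zero>\<^bsub>bop K\<^esub> T = op_tensor K H L \<tau> \<zero>\<^bsub>bop K\<^esub> T'"
proof -
  interpret K: hilbert_space K using L by (simp add: hilbert_tensor_def)
  interpret H: hilbert_space H using L by (simp add: hilbert_tensor_def)
  interpret L: hilbert_space L using L by (simp add: hilbert_tensor_def)
  have \<tau>0: "\<tau> \<zero>\<^bsub>K\<^esub> y = \<zero>\<^bsub>L\<^esub>" if y: "y \<in> carrier H" for y
  proof -
    have "\<tau> (0 \<odot>\<^bsub>K\<^esub> \<zero>\<^bsub>K\<^esub>) y = 0 \<odot>\<^bsub>L\<^esub> \<tau> \<zero>\<^bsub>K\<^esub> y" "\<tau> \<zero>\<^bsub>K\<^esub> y \<in> carrier L"
      using L y K.M.zero_closed unfolding hilbert_tensor_def by blast+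
    then show ?thesis
      using K.smult_l_null[OF K.M.zero_closed] L.smult_l_null by simp
  qed
  have "(\<forall>x\<in>carrier K. \<forall>y\<in>carrier H. S (\<tau> x y) = \<tau> (\<zero>\<^bsub>bop K\<^esub> x) (T y)) \<longleftrightarrow>
      (\<forall>x\<in>carrier K. \<forall>y\<in>carrier H. S (\<tau> x y) = \<tau> (\<zero>\<^bsub>bop K\<^esub> x) (T' y))" for S
    using \<tau>0 H.bop_closed[OF T] H.bop_closed[OF T'] by (simp add: K.bop_apply_simps)
  then show ?thesis unfolding op_tensor_def by simp
qed

text \<open>A multiword operator depends on the point for nonempty multiwords only, and the coefficients of those
  vanish.  The homogeneous parts at two points are therefore equal term by term, and so are the values, whatever they are.\<close>

lemma constant_function_if_coefficients_zero:
  fixes K :: "'k hspace" and U :: "'h itself"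
  assumes zero: "\<And>\<alpha>. \<alpha> \<in> multiwords n \<Longrightarrow> 0 < total_length \<alpha> \<Longrightarrow> A \<alpha> = \<zero>\<^bsub>bop K\<^esub>"
  shows "constant_function U K n A"
  unfolding constant_function_def
proof (intro allI impI ballI)
  fix H :: "'h hspace" and L :: "('k \<times> 'h \<Rightarrow> complex) hspace" and \<tau> X Y
  assume L: "hilbert_tensor K H L \<tau>"
    and X: "X \<in> commuting_tuples H n" and Y: "Y \<in> commuting_tuples H n"
  interpret H: hilbert_space H using L by (simp add: hilbert_tensor_def)
  have eq: "op_tensor K H L \<tau> (A \<alpha>) (multiword_op H X \<alpha>) = op_tensor K H L \<tau> (A \<alpha>) (multiword_op H Y \<alpha>)"
    if \<alpha>: "\<alpha> \<in> multiwords n" for \<alpha>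
  proof (cases "total_length \<alpha> = 0")
    case True
    have "multiword_op H Z \<alpha> = op_prod H (replicate (length n) \<one>\<^bsub>bop H\<^esub>)"
      if "Z \<in> commuting_tuples H n" for Z
    proof -
      have len: "length Z = length n" "length \<alpha> = length n"
        using that \<alpha> by (auto simp: commuting_tuples_def multiwords_def)
      have "map2 (word_op H) Z \<alpha> = replicate (length n) \<one>\<^bsub>bop H\<^esub>"
      proof (rule nth_equalityI)
        fix i assume "i < length (map2 (word_op H) Z \<alpha>)"
        then have i: "i < length n" using len by simp
        then have "\<alpha> ! i = []" using len True by simp
        then show "map2 (word_op H) Z \<alpha> ! i = replicate (length n) \<one>\<^bsub>bop H\<^esub> ! i"
          using i len by (simp add: word_op_def op_prod_def)
      qed (simp add: len)
      then show ?thesis by (simp add: multiword_op_def)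
    qed
    then show ?thesis using X Y by metis
  next
    case False
    then have "A \<alpha> = \<zero>\<^bsub>bop K\<^esub>" using zero[OF \<alpha>] by blast
    then show ?thesis
      using op_tensor_zero_cong[OF L H.multiword_op_bop[OF X \<alpha>] H.multiword_op_bop[OF Y \<alpha>]] by simp
  qed
  have "homogeneous_part K H L \<tau> n A X = homogeneous_part K H L \<tau> n A Y"
  proof (rule ext)
    show "homogeneous_part K H L \<tau> n A X p = homogeneous_part K H L \<tau> n A Y p" for p
      unfolding homogeneous_part_def
      by (rule finsum_cong_plain) (use eq in \<open>simp add: multiwords_of_length_def\<close>)
  qed
  then show "value_at K H L \<tau> n A X = value_at K H L \<tau> n A Y"
    unfolding value_at_def has_value_def by simp
qed

theorem corollary1p9:
  fixes n :: "nat list" and K :: "'k hspace"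
  assumes "n \<noteq> []" and "\<forall>i<length n. n ! i \<ge> 1" and "hilbert_space K"
  shows
    "(\<forall>A C q. entire TYPE('u::infinite universe) K n A \<and> C > 0 \<and> length q = length n \<and>
         growth_bound TYPE('u universe) K n A C q
       \<longrightarrow> polynomial_of_degree_le K n A (sum_list q)) \<and>
     (\<forall>A. entire TYPE('u universe) K n A \<and> bounded_function TYPE('u universe) K n A
       \<longrightarrow> constant_function TYPE('u universe) K n A)"
proof (intro conjI allI impI)
  fix A C q
  assume *: "entire TYPE('u universe) K n A \<and> C > 0 \<and> length q = length n \<and>
    growth_bound TYPE('u universe) K n A C q"
  then have A: "A \<in> multiwords n \<rightarrow> carrier (bop K)"
    using zero_less_one unfolding entire_def free_holomorphic_def by blast
  show "polynomial_of_degree_le K n A (sum_list q)"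
    unfolding polynomial_of_degree_le_def
    using coefficient_eq_zero_of_growth_bound[OF assms(3) A] * less_imp_le by blast
next
  fix A
  assume *: "entire TYPE('u universe) K n A \<and> bounded_function TYPE('u universe) K n A"
  then have A: "A \<in> multiwords n \<rightarrow> carrier (bop K)"
    using zero_less_one unfolding entire_def free_holomorphic_def by blast
  show "constant_function TYPE('u universe) K n A"
    by (rule constant_function_if_coefficients_zero)
      (use coefficient_eq_zero_of_bounded[OF assms(3) A] * in blast)
qed

end
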